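(* Let $s\in(0,1)$, $n>2s$, and let $\Omega\subset\mathbb{R}^n$ be an open bounded set with Lipschitz boundary. Put $2^*:=2n/(n-2s)$. Let $h\in L^\infty(\Omega)\setminus\{0\}$ with $\operatorname{ess\,inf}_{x\in\Omega}h(x)>0$, and let $f:[0,+\infty)\to[0,+\infty)$ be a continuous function, with $F(\xi):=\int_0^\xi f(t)\,dt$, satisfying: (h1) for some $q\in[1,2^* )$ the function $t\mapsto\frac{f(t)}{t^{q-1}}$ is strictly decreasing in $(0,+\infty)$ and $\lim_{t\to+\infty}\frac{f(t)}{t^{q-1}}=0$; (h2) $\displaystyle\liminf_{\xi\to0^+}\frac{F(\xi)}{\xi^2}>\frac{\lambda_{1,s}}{2\operatorname{ess\,inf}_{x\in\Omega}h(x)}$; (h3) there exists $\xi_0>0$ such that $$F(\xi_0)<\frac{\xi_0^2}{2\left(c_q\operatorname{ess\,sup}_{x\in\Omega}h(x)\right)^{2/q}\|h\|_{L^1(\Omega)}^{(q-2)/q}}.$$ Then the problem $$\int_{\mathbb{R}^{2n}}\frac{(u(x)-u(y))(\varphi(x)-\varphi(y))}{|x-y|^{n+2s}}\,dx\,dy=\int_\Omega h(x)f(u(x))\varphi(x)\,dx$$ for every $\varphi\in H^s(\mathbb{R}^n)$ such that $\varphi=0$ a.e. in $\mathbb{R}^n\setminus\Omega$, admits at least one non-negative and non-zero weak solution $u\in H^s(\mathbb{R}^n)$ such that $u=0$ a.e. in $\mathbb{R}^n\setminus\Omega$. Moreover, $u$ is a local minimum of the energy functional $J_K$ on $X_0$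 and satisfies $$\int_{\mathbb{R}^{2n}}\frac{|u(x)-u(y)|^2}{|x-y|^{n+2s}}\,dx\,dy<\left(\frac{\|h\|_{L^1(\Omega)}}{c_q\operatorname{ess\,sup}_{x\in\Omega}h(x)}\right)^{2/q}\xi_0^2.$$
   Context: $H^s(\mathbb{R}^n)$ is the usual fractional Sobolev space, with norm $\|g\|_{L^2(\mathbb{R}^n)}+\big(\int_{\mathbb{R}^{2n}}\frac{|g(x)-g(y)|^2}{|x-y|^{n+2s}}\,dx\,dy\big)^{1/2}$. Let $X_0:=\{g\in H^s(\mathbb{R}^n): g=0\text{ a.e. in }\mathbb{R}^n\setminus\Omega\}$, a Hilbert space with norm $\|v\|_{X_0}:=\big(\int_{\mathbb{R}^{2n}}\frac{|v(x)-v(y)|^2}{|x-y|^{n+2s}}\,dx\,dy\big)^{1/2}$, which embeds continuously in $L^\nu(\mathbb{R}^n)$ for $\nu\in[1,2^*]$. Set $$c_q:=\sup_{u\in X_0\setminus\{0\}}\frac{\|u\|_{L^q(\Omega)}^q}{\|u\|_{X_0}^q}<+\infty,\qquad \lambda_{1,s}:=\min_{u\in X_0\setminus\{0\}}\frac{\|u\|_{X_0}^2}{\int_\Omega u(x)^2\,dx}$$ ($\lambda_{1,s}$ is the first eigenvalue of $(-\Delta)^su=\lambda u$ in $\Omega$, $u=0$ in $\mathbb{R}^n\setminus\Omega$). The energy functional (here $K(x)=|x|^{-(n+2s)}$) is $J_K:X_0\to\mathbb{R}$, $$J_K(u):=\frac12\|u\|_{X_0}^2-\int_\Omega h(x)F(u(x))\,dx,$$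 where $f$ is extended to $\mathbb{R}$ by $f(t):=f(0)$ for $t<0$ and correspondingly $F(\xi)=\int_0^\xi f(t)\,dt$ for all $\xi\in\mathbb{R}$. Non-negativity of $u$ is meant a.e. *)

theory Defs
  imports "HOL-Analysis.Analysis" "HOL-Probability.Essential_Supremum"
begin

text \<open>
  Elements of function spaces are represented by Lebesgue measurable functions; equality to zero
  in such a space is equality to zero almost everywhere.
\<close>

text \<open>
  Near every boundary point, the set is, in some orthonormal coordinate system with last axis \<open>v\<close>,
  the strict epigraph of a Lipschitz function of the remaining coordinates. Those coordinates are
  represented by the orthogonal projection onto the hyperplane \<open>{y. y \<bullet> v = 0}\<close>.
\<close>

definition lipschitz_boundary :: "(real^'n) set \<Rightarrow> bool" where
  "lipschitz_boundary \<Omega> \<longleftrightarrow>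
     (\<forall>p\<in>frontier \<Omega>. \<exists>r>0. \<exists>v. norm v = 1 \<and> (\<exists>L \<gamma>. L-lipschitz_on {y. y \<bullet> v = 0} \<gamma> \<and>
        \<Omega> \<inter> ball p r = {x \<in> ball p r. \<gamma> (x - (x \<bullet> v) *\<^sub>R v) < x \<bullet> v}))"

definition essinf :: "'a measure \<Rightarrow> ('a \<Rightarrow> ereal) \<Rightarrow> ereal" where
  "essinf M f = Sup {z. AE x in M. z \<le> f x}"

definition Linfty :: "'a measure \<Rightarrow> ('a \<Rightarrow> real) set" where
  "Linfty M = {h \<in> borel_measurable M. esssup M (\<lambda>x. ereal \<bar>h x\<bar>) < \<infinity>}"

text \<open>On the diagonal the quotient is \<open>0\<close> by the convention \<open>a / 0 = 0\<close>; the diagonal is a null set.\<close>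

definition gagliardo_quotient ::
    "real \<Rightarrow> (real^'n \<Rightarrow> real) \<Rightarrow> (real^'n \<Rightarrow> real) \<Rightarrow> (real^'n) \<times> (real^'n) \<Rightarrow> real" where
  "gagliardo_quotient s u v =
     (\<lambda>(x, y). (u x - u y) * (v x - v y) / norm (x - y) powr (real CARD('n) + 2 * s))"

definition gagliardo_form :: "real \<Rightarrow> (real^'n \<Rightarrow> real) \<Rightarrow> (real^'n \<Rightarrow> real) \<Rightarrow> real" where
  "gagliardo_form s u v = (LINT z|(lebesgue \<Otimes>\<^sub>M lebesgue). gagliardo_quotient s u v z)"

definition frac_sobolev :: "real \<Rightarrow> (real^'n \<Rightarrow> real) set" where
  "frac_sobolev s = {u \<in> borel_measurable lebesgue.
     integrable lebesgue (\<lambda>x. (u x)\<^sup>2) \<and>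
     integrable (lebesgue \<Otimes>\<^sub>M lebesgue) (gagliardo_quotient s u u)}"

definition X0 :: "real \<Rightarrow> (real^'n) set \<Rightarrow> (real^'n \<Rightarrow> real) set" where
  "X0 s \<Omega> = {u \<in> frac_sobolev s. AE x in lebesgue. x \<notin> \<Omega> \<longrightarrow> u x = 0}"

definition X0_nonzero :: "real \<Rightarrow> (real^'n) set \<Rightarrow> (real^'n \<Rightarrow> real) set" where
  "X0_nonzero s \<Omega> = {u \<in> X0 s \<Omega>. \<not> (AE x in lebesgue. u x = 0)}"

definition X0_norm :: "real \<Rightarrow> (real^'n \<Rightarrow> real) \<Rightarrow> real" where
  "X0_norm s u = sqrt (gagliardo_form s u u)"

definition critical_exponent :: "'n itself \<Rightarrow> real \<Rightarrow> real" where
  "critical_exponent _ s = 2 * real CARD('n) / (real CARD('n) - 2 * s)"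

text \<open>
  The supremum is taken in \<open>[0, \<infinity>]\<close>; for bounded \<open>\<Omega>\<close> and \<open>1 \<le> q\<close> up to the critical exponent it
  is finite by the Sobolev embedding.
\<close>

definition embedding_const :: "real \<Rightarrow> (real^'n) set \<Rightarrow> real \<Rightarrow> ennreal" where
  "embedding_const s \<Omega> q =
     (SUP u\<in>X0_nonzero s \<Omega>.
        (\<integral>\<^sup>+x. ennreal (\<bar>u x\<bar> powr q) \<partial>lebesgue_on \<Omega>) / ennreal (X0_norm s u powr q))"

definition first_eigenvalue :: "real \<Rightarrow> (real^'n) set \<Rightarrow> real" where
  "first_eigenvalue s \<Omega> =
     (LEAST l. \<exists>u\<in>X0_nonzero s \<Omega>. l = (X0_norm s u)\<^sup>2 / (LINT x|lebesgue_on \<Omega>. (u x)\<^sup>2))"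

text \<open>Only the values of \<open>f\<close> on \<open>[0, \<infinity>)\<close> matter below: \<open>f\<close> is extended by \<open>f 0\<close>.\<close>

definition extend0 :: "(real \<Rightarrow> real) \<Rightarrow> real \<Rightarrow> real" where
  "extend0 f t = (if t < 0 then f 0 else f t)"

text \<open>The interval integral is oriented, so this is also the usual primitive for \<open>\<xi> < 0\<close>.\<close>

definition primitive :: "(real \<Rightarrow> real) \<Rightarrow> real \<Rightarrow> real" where
  "primitive f \<xi> = (LBINT t=ereal 0..ereal \<xi>. extend0 f t)"

definition energy ::
    "real \<Rightarrow> (real^'n) set \<Rightarrow> (real^'n \<Rightarrow> real) \<Rightarrow> (real \<Rightarrow> real) \<Rightarrow> (real^'n \<Rightarrow> real) \<Rightarrow> real" where
  "energy s \<Omega> h f u =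
     (X0_norm s u)\<^sup>2 / 2 - (LINT x|lebesgue_on \<Omega>. h x * primitive f (u x))"

definition local_min_on_X0 ::
    "real \<Rightarrow> (real^'n) set \<Rightarrow> ((real^'n \<Rightarrow> real) \<Rightarrow> real) \<Rightarrow> (real^'n \<Rightarrow> real) \<Rightarrow> bool" where
  "local_min_on_X0 s \<Omega> J u \<longleftrightarrow> u \<in> X0 s \<Omega> \<and>
     (\<exists>\<delta>>0. \<forall>v\<in>X0 s \<Omega>. X0_norm s (\<lambda>x. v x - u x) < \<delta> \<longrightarrow> J u \<le> J v)"

text \<open>
  Absolute convergence of the right-hand integral is required explicitly; that of the left-hand one
  is automatic in \<open>X0\<close> by the Cauchy-Schwarz inequality.
\<close>

definition weak_solution ::
    "real \<Rightarrow> (real^'n) set \<Rightarrow> (real^'n \<Rightarrow> real) \<Rightarrow> (real \<Rightarrow> real) \<Rightarrow> (real^'n \<Rightarrow> real) \<Rightarrow> bool" where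
  "weak_solution s \<Omega> h f u \<longleftrightarrow> u \<in> X0 s \<Omega> \<and>
     (\<forall>\<phi>\<in>X0 s \<Omega>.
        integrable (lebesgue_on \<Omega>) (\<lambda>x. h x * extend0 f (u x) * \<phi> x) \<and>
        gagliardo_form s u \<phi> = (LINT x|lebesgue_on \<Omega>. h x * extend0 f (u x) * \<phi> x))"

end

theory Submission
  imports Defs "HOL-Library.Diagonal_Subsequence"
begin

text \<open>
  The solution is a minimizer of the energy over a ball of \<open>X0\<close>. Write \<open>E(u)\<close> for the Gagliardo form
  at \<open>(u, u)\<close>, \<open>J\<close> for the energy, \<open>F\<close> for the primitive of \<open>f\<close>, and let \<open>r\<close> be the bound on
  \<open>E(u)\<close> in the conclusion. Three facts about the ball \<open>E \<le> r\<close> suffice.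

  First, \<open>J\<close> attains its minimum there (\<open>minimizer_on_ball\<close>). The direct method is run on almost
  everywhere convergent subsequences in place of weakly convergent ones. On a cube of side
  \<open>1 / N\<close>, the variance of a function is at most a multiple of \<open>N powr (- 2 * s)\<close> times its
  Gagliardo energy on the cube; hence finitely many averages determine the function in \<open>L\<^sup>2\<close> up to
  a small error, and a bounded sequence has a subsequence that converges in \<open>L\<^sup>2\<close> and almost
  everywhere (\<open>X0_compact\<close>). Fatou's lemma makes \<open>E\<close> lower semicontinuous along it. It also makes the
  potential term upper semicontinuous, because \<open>F t \<le> \<epsilon> * \<bar>t\<bar> powr q + C\<close> for every \<open>\<epsilon> > 0\<close> while
  the integrals of \<open>\<bar>u\<bar> powr q\<close> stay bounded.

  Second, \<open>J > 0 = J(0)\<close> on the sphere \<open>E = r\<close>. As \<open>f t / t powr (q - 1)\<close> decreases,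
  \<open>F\<close> is a concave function of \<open>t powr q\<close> and lies below its tangent at \<open>\<xi>\<^sub>0\<close>
  (\<open>primitive_le_tangent\<close>). Integrating the tangent against \<open>h\<close> is Jensen's inequality in disguise:
  it bounds the potential term on the ball by \<open>h_L1 * F \<xi>\<^sub>0\<close> (\<open>potential_le_Jensen\<close>), and the
  hypothesis on \<open>\<xi>\<^sub>0\<close> says exactly that this is less than \<open>r / 2\<close>.

  Third, \<open>J < 0\<close> somewhere in the ball: the first eigenvalue is attained at some \<open>w\<close>
  (\<open>first_eigenvalue_attained\<close>), and the lower bound on \<open>F \<xi> / \<xi>\<^sup>2\<close> near \<open>0\<close> makes the potential term
  win along small multiples of \<open>\<bar>w\<bar>\<close> (\<open>negative_energy_near_zero\<close>).

  So the minimum is negative, and the minimizer is nonzero and lies inside the ball; there the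
  derivative of \<open>J\<close> vanishes, which is the weak equation (\<open>interior_minimizer\<close>). Taking the positive
  part increases neither \<open>E\<close> nor \<open>J\<close>, so the minimizer may be taken non-negative.

  The embedding constant is known to be positive and finite from the hypothesis on \<open>\<xi>\<^sub>0\<close> itself: if it
  were \<open>0\<close> or infinite, its real value would be \<open>0\<close> and the bound on \<open>F \<xi>\<^sub>0\<close> would read \<open>F \<xi>\<^sub>0 < 0\<close>,
  with division by \<open>0\<close> giving \<open>0\<close>. Finiteness supplies the integrability of \<open>\<bar>u\<bar> powr q\<close> throughout.
\<close>

section \<open>The Gagliardo form\<close>

lemma sigma_finite_lebesgue: "sigma_finite_measure (lebesgue :: 'a::euclidean_space measure)"
proof
  obtain A :: "'a set set" where "countable A" "A \<subseteq> sets lborel" "\<Union>A = space lborel"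
      "\<forall>a\<in>A. emeasure lborel a \<noteq> \<infinity>"
    using lborel.sigma_finite_countable by blast
  then show "\<exists>A::'a set set. countable A \<and> A \<subseteq> sets lebesgue \<and> \<Union>A = space lebesgue
      \<and> (\<forall>a\<in>A. emeasure lebesgue a \<noteq> \<infinity>)"
    by (intro exI[of _ A]) (use emeasure_completion in \<open>auto simp: subset_eq\<close>)
qed

interpretation lebesgue_pair:
  pair_sigma_finite "lebesgue :: 'a::euclidean_space measure" "lebesgue :: 'a measure"
  by (intro pair_sigma_finite.intro sigma_finite_lebesgue)

lemma measurable_gagliardo_quotient [measurable]:
  fixes u v :: "real^'n \<Rightarrow> real"
  assumes [measurable]: "u \<in> borel_measurable lebesgue" "v \<in> borel_measurable lebesgue"
  shows "gagliardo_quotient s u v \<in> borel_measurable (lebesgue \<Otimes>\<^sub>M lebesgue)"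
proof -
  have [measurable]: "(\<lambda>z::(real^'n) \<times> (real^'n). fst z) \<in> borel_measurable (lebesgue \<Otimes>\<^sub>M lebesgue)"
       "(\<lambda>z::(real^'n) \<times> (real^'n). snd z) \<in> borel_measurable (lebesgue \<Otimes>\<^sub>M lebesgue)"
    by (rule measurable_compose[OF measurable_fst], rule measurable_completion, simp)
       (rule measurable_compose[OF measurable_snd], rule measurable_completion, simp)
  show ?thesis
    unfolding gagliardo_quotient_def case_prod_beta by measurable
qed

lemma gagliardo_quotient_nonneg: "0 \<le> gagliardo_quotient s u u z"
  by (cases z) (simp add: gagliardo_quotient_def)

lemma gagliardo_form_nonneg: "0 \<le> gagliardo_form s u u"
  unfolding gagliardo_form_def by (intro Bochner_Integration.integral_nonneg gagliardo_quotient_nonneg)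

lemma X0_norm_power2: "(X0_norm s u)\<^sup>2 = gagliardo_form s u u"
  by (simp add: X0_norm_def gagliardo_form_nonneg)

lemma X0_D:
  assumes "u \<in> X0 s \<Omega>"
  shows "u \<in> borel_measurable lebesgue" "integrable lebesgue (\<lambda>x. (u x)\<^sup>2)"
    "integrable (lebesgue \<Otimes>\<^sub>M lebesgue) (gagliardo_quotient s u u)"
    "AE x in lebesgue. x \<notin> \<Omega> \<longrightarrow> u x = 0"
  using assms by (auto simp: X0_def frac_sobolev_def)

lemma integrable_gagliardo_quotient:
  fixes u v :: "real^'n \<Rightarrow> real"
  assumes "u \<in> X0 s \<Omega>" "v \<in> X0 s \<Omega>"
  shows "integrable (lebesgue \<Otimes>\<^sub>M lebesgue) (gagliardo_quotient s u v)"
proof (rule Bochner_Integration.integrable_bound)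
  show "integrable (lebesgue \<Otimes>\<^sub>M lebesgue) (\<lambda>z. gagliardo_quotient s u u z + gagliardo_quotient s v v z)"
    using assms by (simp add: X0_D)
  show "gagliardo_quotient s u v \<in> borel_measurable (lebesgue \<Otimes>\<^sub>M lebesgue)"
    by (intro measurable_gagliardo_quotient X0_D(1)[OF assms(1)] X0_D(1)[OF assms(2)])
  show "AE z in lebesgue \<Otimes>\<^sub>M lebesgue. norm (gagliardo_quotient s u v z)
          \<le> norm (gagliardo_quotient s u u z + gagliardo_quotient s v v z)"
  proof (rule AE_I2)
    fix z :: "(real^'n) \<times> (real^'n)"
    obtain x y where z: "z = (x, y)" by (cases z)
    have "\<bar>a * b\<bar> \<le> a * a + b * b" for a b :: real
    proof -
      have "2 * \<bar>a * b\<bar> \<le> a * a + b * b"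
        using zero_le_power2[of "\<bar>a\<bar> - \<bar>b\<bar>"] by (simp add: power2_eq_square abs_mult algebra_simps)
      then show ?thesis by simp
    qed
    then have "\<bar>(u x - u y) * (v x - v y)\<bar> / norm (x - y) powr (real CARD('n) + 2 * s)
       \<le> ((u x - u y) * (u x - u y) + (v x - v y) * (v x - v y)) / norm (x - y) powr (real CARD('n) + 2 * s)"
      by (intro divide_right_mono) auto
    then show "norm (gagliardo_quotient s u v z)
          \<le> norm (gagliardo_quotient s u u z + gagliardo_quotient s v v z)"
      using gagliardo_quotient_nonneg[of s u z] gagliardo_quotient_nonneg[of s v z]
      by (simp add: z gagliardo_quotient_def abs_divide add_divide_distrib)
  qed
qed

lemma gagliardo_quotient_add_scale:
  "gagliardo_quotient s (\<lambda>x. u x + t * v x) (\<lambda>x. u x + t * v x) z =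
   gagliardo_quotient s u u z + (2 * t * gagliardo_quotient s u v z + t\<^sup>2 * gagliardo_quotient s v v z)"
  by (cases z) (simp add: gagliardo_quotient_def diff_divide_distrib add_divide_distrib
      algebra_simps power2_eq_square)

lemma X0_add_scale:
  assumes "u \<in> X0 s \<Omega>" "v \<in> X0 s \<Omega>"
  shows "(\<lambda>x. u x + t * v x) \<in> X0 s \<Omega>"
proof -
  note [measurable] = X0_D(1)[OF assms(1)] X0_D(1)[OF assms(2)]
  have "integrable lebesgue (\<lambda>x. (u x + t * v x)\<^sup>2)"
  proof (rule Bochner_Integration.integrable_bound)
    show "integrable lebesgue (\<lambda>x. 2 * (u x)\<^sup>2 + 2 * t\<^sup>2 * (v x)\<^sup>2)"
      using assms by (simp add: X0_D)
    show "AE x in lebesgue. norm ((u x + t * v x)\<^sup>2) \<le> norm (2 * (u x)\<^sup>2 + 2 * t\<^sup>2 * (v x)\<^sup>2)"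
    proof (rule AE_I2)
      fix x
      have "0 \<le> (u x - t * v x)\<^sup>2" by simp
      then have "(u x + t * v x)\<^sup>2 \<le> 2 * (u x)\<^sup>2 + 2 * t\<^sup>2 * (v x)\<^sup>2"
        by (simp add: power2_eq_square algebra_simps)
      then show "norm ((u x + t * v x)\<^sup>2) \<le> norm (2 * (u x)\<^sup>2 + 2 * t\<^sup>2 * (v x)\<^sup>2)"
        by simp
    qed
  qed measurable
  moreover have "integrable (lebesgue \<Otimes>\<^sub>M lebesgue)
      (gagliardo_quotient s (\<lambda>x. u x + t * v x) (\<lambda>x. u x + t * v x))"
    unfolding gagliardo_quotient_add_scale[abs_def]
    by (intro Bochner_Integration.integrable_add integrable_mult_right
        integrable_gagliardo_quotient[of _ _ \<Omega>] assms)
  moreover have "AE x in lebesgue. x \<notin> \<Omega> \<longrightarrow> u x + t * v x = 0"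
    using X0_D(4)[OF assms(1)] X0_D(4)[OF assms(2)] by eventually_elim auto
  ultimately show ?thesis
    by (simp add: X0_def frac_sobolev_def)
qed

lemma gagliardo_form_add_scale:
  assumes "u \<in> X0 s \<Omega>" "v \<in> X0 s \<Omega>"
  shows "gagliardo_form s (\<lambda>x. u x + t * v x) (\<lambda>x. u x + t * v x) =
     gagliardo_form s u u + 2 * t * gagliardo_form s u v + t\<^sup>2 * gagliardo_form s v v"
  unfolding gagliardo_form_def gagliardo_quotient_add_scale[abs_def]
  using integrable_gagliardo_quotient[OF assms] integrable_gagliardo_quotient[OF assms(1) assms(1)]
    integrable_gagliardo_quotient[OF assms(2) assms(2)]
  by simp

lemma X0_zero: "(\<lambda>x::real^'n. 0) \<in> X0 s \<Omega>"
proof -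
  have "gagliardo_quotient s (\<lambda>x. 0) (\<lambda>x. 0) = (\<lambda>z::(real^'n) \<times> (real^'n). 0)"
    by (auto simp: gagliardo_quotient_def)
  then show ?thesis by (simp add: X0_def frac_sobolev_def)
qed

lemma X0_scale:
  assumes "u \<in> X0 s \<Omega>"
  shows "(\<lambda>x. t * u x) \<in> X0 s \<Omega>"
  using X0_add_scale[OF X0_zero assms, of t] by simp

lemma X0_diff:
  assumes "u \<in> X0 s \<Omega>" "v \<in> X0 s \<Omega>"
  shows "(\<lambda>x. u x - v x) \<in> X0 s \<Omega>"
  using X0_add_scale[OF assms, of "-1"] by simp

lemma gagliardo_form_scale:
  "gagliardo_form s (\<lambda>x. t * u x) (\<lambda>x. t * u x) = t\<^sup>2 * gagliardo_form s u u"
proof -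
  have "gagliardo_quotient s (\<lambda>x. t * u x) (\<lambda>x. t * u x) = (\<lambda>z. t\<^sup>2 * gagliardo_quotient s u u z)"
    by (auto simp: gagliardo_quotient_def fun_eq_iff power2_eq_square algebra_simps)
  then show ?thesis by (simp add: gagliardo_form_def)
qed

text \<open>Young's inequality with weights: the cross term is traded for arbitrarily little of the first
  summand, which makes the form continuous along small perturbations.\<close>

lemma gagliardo_form_add_le:
  fixes u v :: "real^'n \<Rightarrow> real"
  assumes "u \<in> X0 s \<Omega>" "v \<in> X0 s \<Omega>" "0 < \<eta>"
  shows "gagliardo_form s (\<lambda>x. u x + v x) (\<lambda>x. u x + v x)
     \<le> (1 + \<eta>) * gagliardo_form s u u + (1 + 1 / \<eta>) * gagliardo_form s v v"
proof -
  have "0 \<le> gagliardo_form s (\<lambda>x. \<eta> * u x + (-1) * v x) (\<lambda>x. \<eta> * u x + (-1) * v x)"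
    by (rule gagliardo_form_nonneg)
  also have "\<dots> = \<eta>\<^sup>2 * gagliardo_form s u u + 2 * (-1) * gagliardo_form s (\<lambda>x. \<eta> * u x) v + gagliardo_form s v v"
    by (subst gagliardo_form_add_scale[OF X0_scale[OF assms(1)] assms(2)])
       (simp add: gagliardo_form_scale)
  also have "gagliardo_form s (\<lambda>x. \<eta> * u x) v = \<eta> * gagliardo_form s u v"
  proof -
    have "gagliardo_quotient s (\<lambda>x. \<eta> * u x) v = (\<lambda>z. \<eta> * gagliardo_quotient s u v z)"
      by (auto simp: gagliardo_quotient_def fun_eq_iff algebra_simps)
    then show ?thesis by (simp add: gagliardo_form_def)
  qed
  finally have "2 * \<eta> * gagliardo_form s u v \<le> \<eta>\<^sup>2 * gagliardo_form s u u + gagliardo_form s v v"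
    by simp
  then have "2 * gagliardo_form s u v \<le> \<eta> * gagliardo_form s u u + gagliardo_form s v v / \<eta>"
    using \<open>0 < \<eta>\<close> by (simp add: field_simps power2_eq_square)
  then show ?thesis
    using gagliardo_form_add_scale[OF assms(1,2), of 1] by (simp add: algebra_simps)
qed

text \<open>Composition with a contraction does not increase any difference quotient. This is what lets
  minimizers be replaced by their positive parts or absolute values.\<close>

lemma
  fixes u :: "real^'n \<Rightarrow> real"
  assumes u: "u \<in> X0 s \<Omega>" and T: "1-lipschitz_on UNIV T" "T 0 = 0"
  shows X0_contraction: "(\<lambda>x. T (u x)) \<in> X0 s \<Omega>"
    and gagliardo_form_contraction:
      "gagliardo_form s (\<lambda>x. T (u x)) (\<lambda>x. T (u x)) \<le> gagliardo_form s u u"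
proof -
  have T_le: "\<bar>T a - T b\<bar> \<le> \<bar>a - b\<bar>" for a b
    using lipschitz_onD[OF T(1), of a b] by (simp add: dist_real_def)
  have T_bound: "\<bar>T a\<bar> \<le> \<bar>a\<bar>" for a
    using T_le[of a 0] T(2) by simp
  have "continuous_on UNIV T"
    using T(1) by (rule lipschitz_on_continuous_on)
  then have [measurable]: "T \<in> borel_measurable borel"
    by (rule borel_measurable_continuous_onI)
  note [measurable] = X0_D(1)[OF u]
  have quot: "gagliardo_quotient s (\<lambda>x. T (u x)) (\<lambda>x. T (u x)) z \<le> gagliardo_quotient s u u z" for z
  proof -
    obtain x y where z: "z = (x, y)" by (cases z)
    have "(T (u x) - T (u y))\<^sup>2 \<le> (u x - u y)\<^sup>2"
      using T_le by (simp add: abs_le_square_iff)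
    then show ?thesis
      unfolding z by (simp add: gagliardo_quotient_def power2_eq_square divide_right_mono)
  qed
  have int: "integrable (lebesgue \<Otimes>\<^sub>M lebesgue) (gagliardo_quotient s (\<lambda>x. T (u x)) (\<lambda>x. T (u x)))"
    by (rule Bochner_Integration.integrable_bound[OF X0_D(3)[OF u]])
       (auto simp del: split_paired_All intro!: AE_I2 simp: abs_of_nonneg[OF gagliardo_quotient_nonneg] quot)
  then show "gagliardo_form s (\<lambda>x. T (u x)) (\<lambda>x. T (u x)) \<le> gagliardo_form s u u"
    unfolding gagliardo_form_def by (intro integral_mono X0_D(3)[OF u] quot)
  have "integrable lebesgue (\<lambda>x. (T (u x))\<^sup>2)"
    by (rule Bochner_Integration.integrable_bound[OF X0_D(2)[OF u]])
       (use T_bound in \<open>auto simp: abs_le_square_iff\<close>)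
  moreover have "AE x in lebesgue. x \<notin> \<Omega> \<longrightarrow> T (u x) = 0"
    using X0_D(4)[OF u] by eventually_elim (simp add: T(2))
  ultimately show "(\<lambda>x. T (u x)) \<in> X0 s \<Omega>"
    using int by (simp add: X0_def frac_sobolev_def)
qed

section \<open>Compactness\<close>

text \<open>Expanding the square gives \<open>2 * m * (\<integral>w\<^sup>2) - 2 * (\<integral>w)\<^sup>2\<close> for the integral of \<open>(w x - w y)\<^sup>2\<close> over
  \<open>Q \<times> Q\<close>, where \<open>m\<close> is the measure of \<open>Q\<close>. On \<open>Q \<times> Q\<close> distances are at most \<open>d\<close>, so this square is
  at most \<open>d powr (n + 2 * s)\<close> times the Gagliardo quotient.\<close>

lemma cell_poincare:
  fixes w :: "real^'n \<Rightarrow> real"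
  assumes w: "w \<in> X0 s \<Omega>" and s: "0 \<le> s"
    and Q: "Q \<in> lmeasurable" "0 < measure lebesgue Q"
    and d: "\<forall>x\<in>Q. \<forall>y\<in>Q. norm (x - y) \<le> d"
  shows "integrable lebesgue (\<lambda>x. indicator Q x * (w x)\<^sup>2)" (is "integrable _ ?w2")
    and "integrable lebesgue (\<lambda>x. indicator Q x * w x)" (is "integrable _ ?w1")
    and "(LINT x|lebesgue. indicator Q x * (w x)\<^sup>2) \<le>
           (LINT x|lebesgue. indicator Q x * w x)\<^sup>2 / measure lebesgue Q
           + d powr (real CARD('n) + 2 * s) / (2 * measure lebesgue Q)
             * (LINT z|(lebesgue \<Otimes>\<^sub>M lebesgue). indicator (Q \<times> Q) z * gagliardo_quotient s w w z)"
proof -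
  note [measurable] = X0_D(1)[OF w]
  have [measurable]: "Q \<in> sets lebesgue" using Q(1) by auto
  let ?m = "measure lebesgue Q" and ?p = "real CARD('n) + 2 * s"
  have ind: "integrable lebesgue (\<lambda>x. indicator Q x :: real)"
    using Q(1) by (simp add: fmeasurable_def)
  show int_w2: "integrable lebesgue ?w2"
    by (rule Bochner_Integration.integrable_bound[OF X0_D(2)[OF w]]) (auto simp: indicator_def)
  show int_w1: "integrable lebesgue ?w1"
  proof (rule Bochner_Integration.integrable_bound)
    show "integrable lebesgue (\<lambda>x. indicator Q x + indicator Q x * (w x)\<^sup>2)"
      using ind int_w2 by simp
    have "\<bar>t\<bar> \<le> 1 + t\<^sup>2" for t :: real
      using zero_le_power2[of "\<bar>t\<bar> - 1"] by (simp add: power2_eq_square algebra_simps)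
    then show "AE x in lebesgue. norm (indicator Q x * w x) \<le> norm (indicator Q x + indicator Q x * (w x)\<^sup>2)"
      by (auto intro!: AE_I2 simp: indicator_def)
  qed measurable
  let ?g = "\<lambda>z. indicator (Q \<times> Q) z * (w (fst z) - w (snd z))\<^sup>2"
  let ?q = "\<lambda>z. d powr ?p * (indicator (Q \<times> Q) z * gagliardo_quotient s w w z)"
  have [measurable]: "Q \<times> Q \<in> sets (lebesgue \<Otimes>\<^sub>M lebesgue)" by measurable
  have le: "?g z \<le> ?q z" for z
  proof (cases "z \<in> Q \<times> Q \<and> fst z \<noteq> snd z")
    case True
    then obtain x y where z: "z = (x, y)" "x \<in> Q" "y \<in> Q" "x \<noteq> y" by (cases z) auto
    have "norm (x - y) powr ?p \<le> d powr ?p"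
      using d z(2,3) s by (intro powr_mono2) auto
    then have "(w x - w y)\<^sup>2 * norm (x - y) powr ?p \<le> (w x - w y)\<^sup>2 * d powr ?p"
      by (intro mult_left_mono) auto
    moreover have "0 < norm (x - y) powr ?p" using z(4) by simp
    ultimately have "(w x - w y)\<^sup>2 \<le> d powr ?p * (w x - w y)\<^sup>2 / norm (x - y) powr ?p"
      by (simp add: pos_le_divide_eq mult.commute)
    then show ?thesis
      using z by (simp add: gagliardo_quotient_def power2_eq_square)
  next
    case False
    then show ?thesis by (cases z) (auto simp: gagliardo_quotient_def indicator_def)
  qed
  have int_q: "integrable (lebesgue \<Otimes>\<^sub>M lebesgue) (\<lambda>z. indicator (Q \<times> Q) z * gagliardo_quotient s w w z)"
    by (rule Bochner_Integration.integrable_bound[OF X0_D(3)[OF w]])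
       (auto simp del: split_paired_All intro!: AE_I2 split: split_indicator)
  then have int_q': "integrable (lebesgue \<Otimes>\<^sub>M lebesgue) ?q" by simp
  have int_g: "integrable (lebesgue \<Otimes>\<^sub>M lebesgue) ?g"
    using le by (intro Bochner_Integration.integrable_bound[OF int_q'])
      (auto simp del: split_paired_All intro!: AE_I2 order_trans[OF le])
  define A where "A = (LINT x|lebesgue. ?w1 x)"
  define B where "B = (LINT x|lebesgue. ?w2 x)"
  have inner: "(LINT y|lebesgue. ?g (x, y)) = ?m * ?w2 x + (- 2 * A * ?w1 x + B * indicator Q x)" for x
  proof -
    have "?g (x, y) = indicator Q x * (w x)\<^sup>2 * indicator Q y
        + (- 2 * indicator Q x * w x * ?w1 y + indicator Q x * ?w2 y)" for y
      by (simp add: indicator_times power2_eq_square algebra_simps)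
    then have "(LINT y|lebesgue. ?g (x, y)) = indicator Q x * (w x)\<^sup>2 * ?m
        + (- 2 * indicator Q x * w x * A + indicator Q x * B)"
      using ind int_w1 int_w2 by (simp add: A_def B_def)
    then show ?thesis by (simp add: algebra_simps)
  qed
  have "(LINT z|(lebesgue \<Otimes>\<^sub>M lebesgue). ?g z) = (LINT x|lebesgue. LINT y|lebesgue. ?g (x, y))"
    using lebesgue_pair.integral_fst'[OF int_g] by simp
  also have "\<dots> = ?m * B + (- 2 * A * A + B * ?m)"
    unfolding inner using ind int_w1 int_w2 by (simp add: A_def B_def)
  finally have "2 * ?m * B - 2 * A\<^sup>2 = (LINT z|(lebesgue \<Otimes>\<^sub>M lebesgue). ?g z)"
    by (simp add: power2_eq_square)
  also have "\<dots> \<le> (LINT z|(lebesgue \<Otimes>\<^sub>M lebesgue). ?q z)"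
    by (intro integral_mono int_g int_q' le)
  also have "\<dots> = d powr ?p * (LINT z|(lebesgue \<Otimes>\<^sub>M lebesgue). indicator (Q \<times> Q) z * gagliardo_quotient s w w z)"
    by simp
  finally show "(LINT x|lebesgue. indicator Q x * (w x)\<^sup>2) \<le>
           (LINT x|lebesgue. indicator Q x * w x)\<^sup>2 / measure lebesgue Q
           + d powr (real CARD('n) + 2 * s) / (2 * measure lebesgue Q)
             * (LINT z|(lebesgue \<Otimes>\<^sub>M lebesgue). indicator (Q \<times> Q) z * gagliardo_quotient s w w z)"
    using Q(2) unfolding A_def B_def by (simp add: field_simps)
qed

text \<open>A half-open cube of side \<open>1 / N\<close>. With the floor function, cells of different index are
  disjoint and the cells cover the space by definition.\<close>

definition grid_cell :: "nat \<Rightarrow> ('n \<Rightarrow> int) \<Rightarrow> (real^'n) set" where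
  "grid_cell N a = {x. \<forall>i. \<lfloor>real N * x $ i\<rfloor> = a i}"

lemma grid_cell_props:
  fixes a :: "'n::finite \<Rightarrow> int"
  assumes "0 < N"
  shows grid_cell_diameter:
      "\<forall>x\<in>grid_cell N a. \<forall>y\<in>grid_cell N a. norm (x - y) \<le> real CARD('n) / real N"
    and grid_cell_lmeasurable: "grid_cell N a \<in> lmeasurable"
    and measure_grid_cell: "(1 / real N) ^ CARD('n) \<le> measure lebesgue (grid_cell N a)"
proof -
  have iff: "\<lfloor>real N * t\<rfloor> = k \<longleftrightarrow> of_int k / real N \<le> t \<and> t < (of_int k + 1) / real N" for t k
    using assms by (simp add: floor_eq_iff field_simps)
  show "\<forall>x\<in>grid_cell N a. \<forall>y\<in>grid_cell N a. norm (x - y) \<le> real CARD('n) / real N"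
  proof (intro ballI)
    fix x y assume xy: "x \<in> grid_cell N a" "y \<in> grid_cell N a"
    have "\<bar>(x - y) $ i\<bar> \<le> 1 / real N" for i
    proof -
      have "of_int (a i) / real N \<le> x $ i" "x $ i < of_int (a i) / real N + 1 / real N"
        "of_int (a i) / real N \<le> y $ i" "y $ i < of_int (a i) / real N + 1 / real N"
        using xy unfolding grid_cell_def iff by (auto simp: add_divide_distrib)
      then show ?thesis by simp
    qed
    then have "(\<Sum>i\<in>UNIV. \<bar>(x - y) $ i\<bar>) \<le> real CARD('n) * (1 / real N)"
      using sum_bounded_above[of UNIV "\<lambda>i. \<bar>(x - y) $ i\<bar>" "1 / real N"] by simp
    then show "norm (x - y) \<le> real CARD('n) / real N" using norm_le_l1_cart[of "x - y"] by simp
  qed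
  let ?l = "(\<chi> i. of_int (a i) / real N) :: real^'n" and ?u = "(\<chi> i. (of_int (a i) + 1) / real N) :: real^'n"
  have sub: "box ?l ?u \<subseteq> grid_cell N a" "grid_cell N a \<subseteq> cbox ?l ?u"
    by (auto simp: grid_cell_def iff mem_box_cart less_imp_le)
  have "grid_cell N a \<in> sets borel"
    unfolding grid_cell_def by measurable
  then have "grid_cell N a \<in> sets lebesgue" by simp
  then show lm: "grid_cell N a \<in> lmeasurable"
    using sub(2) lmeasurable_cbox fmeasurableI2 by blast
  have "measure lborel (cbox ?l ?u) = (\<Prod>i\<in>UNIV. ?u $ i - ?l $ i)"
    using assms by (intro content_cbox_cart) (auto simp: interval_eq_empty_cart divide_strict_right_mono not_less field_simps)
  also have "\<dots> = (1 / real N) ^ CARD('n)"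
    by (simp add: diff_divide_distrib add_divide_distrib)
  finally have "(1 / real N) ^ CARD('n) = measure lebesgue (box ?l ?u)"
    by (simp add: measure_def emeasure_lborel_box_eq emeasure_lborel_cbox_eq)
  also have "\<dots> \<le> measure lebesgue (grid_cell N a)"
    by (intro measure_mono_fmeasurable sub(1) lm) auto
  finally show "(1 / real N) ^ CARD('n) \<le> measure lebesgue (grid_cell N a)" .
qed

definition grid_indices :: "(real^'n) set \<Rightarrow> nat \<Rightarrow> ('n \<Rightarrow> int) set" where
  "grid_indices \<Omega> N = {a. grid_cell N a \<inter> \<Omega> \<noteq> {}}"

lemma finite_grid_indices:
  fixes \<Omega> :: "(real^'n) set"
  assumes "bounded \<Omega>"
  shows "finite (grid_indices \<Omega> N)"
proof -
  obtain R where R: "\<And>x. x \<in> \<Omega> \<Longrightarrow> norm x \<le> R"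
    using assms by (auto simp: bounded_iff)
  have "grid_indices \<Omega> N \<subseteq> PiE UNIV (\<lambda>_. {- \<lceil>real N * R\<rceil> - 1..\<lceil>real N * R\<rceil> + 1})"
  proof
    fix a assume "a \<in> grid_indices \<Omega> N"
    then obtain x where x: "x \<in> \<Omega>" "\<And>i. \<lfloor>real N * x $ i\<rfloor> = a i"
      by (auto simp: grid_indices_def grid_cell_def)
    have "a i \<in> {- \<lceil>real N * R\<rceil> - 1..\<lceil>real N * R\<rceil> + 1}" for i
    proof -
      have "\<bar>x $ i\<bar> \<le> R" using component_le_norm_cart[of x i] R[OF x(1)] by simp
      then have "\<bar>real N * x $ i\<bar> \<le> real N * R" by (simp add: abs_mult mult_left_mono)
      then have "real N * x $ i \<le> real N * R" "- (real N * R) \<le> real N * x $ i" by auto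
      then show ?thesis using x(2)[of i] by (simp, linarith)
    qed
    then show "a \<in> PiE UNIV (\<lambda>_. {- \<lceil>real N * R\<rceil> - 1..\<lceil>real N * R\<rceil> + 1})" by (simp add: PiE_UNIV_domain)
  qed
  then show ?thesis
    by (rule finite_subset) (intro finite_PiE; simp)
qed

text \<open>The diameter to the power \<open>n + 2 * s\<close> divided by the volume of a cell is of order
  \<open>N powr (- 2 * s)\<close>, which tends to \<open>0\<close>: up to an error controlled by the Gagliardo form, the
  \<open>L\<^sup>2\<close> norm depends only on finitely many cell integrals.\<close>

lemma grid_poincare:
  fixes w :: "real^'n \<Rightarrow> real"
  assumes w: "w \<in> X0 s \<Omega>" and s: "0 \<le> s" and \<Omega>: "bounded \<Omega>" and N: "0 < N"
  shows "(LINT x|lebesgue. (w x)\<^sup>2) \<le>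
     real N ^ CARD('n) * (\<Sum>a\<in>grid_indices \<Omega> N. (LINT x|lebesgue. indicator (grid_cell N a) x * w x)\<^sup>2)
     + real CARD('n) powr (real CARD('n) + 2 * s) * real N powr (- 2 * s) * gagliardo_form s w w"
proof -
  let ?I = "grid_indices \<Omega> N" and ?p = "real CARD('n) + 2 * s"
  note [measurable] = X0_D(1)[OF w]
  note fin = finite_grid_indices[OF \<Omega>, of N]
  note lm = grid_cell_lmeasurable[OF N]
  have [measurable]: "grid_cell N a \<in> sets lebesgue" for a :: "'n \<Rightarrow> int" using lm by auto
  have m0: "0 < measure lebesgue (grid_cell N a)" for a :: "'n \<Rightarrow> int"
    using measure_grid_cell[OF N, of a] N by (meson less_le_trans zero_less_power zero_less_divide_1_iff of_nat_0_less_iff)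
  note cp = cell_poincare[OF w s lm m0 grid_cell_diameter[OF N]]
  let ?D = "\<lambda>a. LINT z|(lebesgue \<Otimes>\<^sub>M lebesgue). indicator (grid_cell N a \<times> grid_cell N a) z * gagliardo_quotient s w w z"
  have D: "0 \<le> ?D a" for a
    by (intro Bochner_Integration.integral_nonneg mult_nonneg_nonneg gagliardo_quotient_nonneg) simp
  have one_cell: "(\<Sum>a\<in>?I. indicator (grid_cell N a) x * c) = (if (\<lambda>i. \<lfloor>real N * x $ i\<rfloor>) \<in> ?I then c else 0)"
    for x and c :: real
  proof -
    have "indicator (grid_cell N a) x * c = (if a = (\<lambda>i. \<lfloor>real N * x $ i\<rfloor>) then c else 0)" for a
      by (auto simp: grid_cell_def indicator_def)
    then show ?thesis using fin by simp
  qed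
  have "(LINT x|lebesgue. (w x)\<^sup>2) = (LINT x|lebesgue. (\<Sum>a\<in>?I. indicator (grid_cell N a) x * (w x)\<^sup>2))"
  proof (rule integral_cong_AE)
    show "AE x in lebesgue. (w x)\<^sup>2 = (\<Sum>a\<in>?I. indicator (grid_cell N a) x * (w x)\<^sup>2)"
      using X0_D(4)[OF w] unfolding one_cell
      by eventually_elim (auto simp: grid_indices_def grid_cell_def)
  qed measurable
  also have "\<dots> = (\<Sum>a\<in>?I. LINT x|lebesgue. indicator (grid_cell N a) x * (w x)\<^sup>2)"
    by (rule Bochner_Integration.integral_sum) (rule cp(1))
  also have "\<dots> \<le> (\<Sum>a\<in>?I. real N ^ CARD('n) * (LINT x|lebesgue. indicator (grid_cell N a) x * w x)\<^sup>2
      + real CARD('n) powr ?p * real N powr (- 2 * s) * ?D a)"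
  proof (rule sum_mono)
    fix a :: "'n \<Rightarrow> int"
    let ?m = "measure lebesgue (grid_cell N a)"
    have inv: "1 / ?m \<le> real N ^ CARD('n)"
      using measure_grid_cell[OF N, of a] m0[of a] N
      by (simp add: field_simps power_divide)
    have "(real CARD('n) / real N) powr ?p / (2 * ?m) \<le> (real CARD('n) / real N) powr ?p * (1 / ?m)"
      using m0[of a] by (simp add: field_simps)
    also have "\<dots> \<le> (real CARD('n) / real N) powr ?p * real N ^ CARD('n)"
      by (intro mult_left_mono inv) auto
    also have "\<dots> = real CARD('n) powr ?p * real N powr (- 2 * s)"
      using N by (simp add: powr_divide powr_realpow[symmetric] powr_add powr_minus field_simps)
    finally have *: "(real CARD('n) / real N) powr ?p / (2 * ?m) \<le> real CARD('n) powr ?p * real N powr (- 2 * s)" .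
    have "(LINT x|lebesgue. indicator (grid_cell N a) x * w x)\<^sup>2 / ?m
        \<le> real N ^ CARD('n) * (LINT x|lebesgue. indicator (grid_cell N a) x * w x)\<^sup>2"
      using mult_right_mono[OF inv, of "(LINT x|lebesgue. indicator (grid_cell N a) x * w x)\<^sup>2"] by simp
    moreover have "(real CARD('n) / real N) powr ?p / (2 * ?m) * ?D a
        \<le> real CARD('n) powr ?p * real N powr (- 2 * s) * ?D a"
      by (intro mult_right_mono * D)
    ultimately show "(LINT x|lebesgue. indicator (grid_cell N a) x * (w x)\<^sup>2)
      \<le> real N ^ CARD('n) * (LINT x|lebesgue. indicator (grid_cell N a) x * w x)\<^sup>2
      + real CARD('n) powr ?p * real N powr (- 2 * s) * ?D a"
      using cp(3)[of a] by linarith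
  qed
  also have "\<dots> = real N ^ CARD('n) * (\<Sum>a\<in>?I. (LINT x|lebesgue. indicator (grid_cell N a) x * w x)\<^sup>2)
     + real CARD('n) powr ?p * real N powr (- 2 * s) * (\<Sum>a\<in>?I. ?D a)"
    by (simp add: sum.distrib sum_distrib_left)
  also have "(\<Sum>a\<in>?I. ?D a) \<le> gagliardo_form s w w"
  proof -
    have int: "integrable (lebesgue \<Otimes>\<^sub>M lebesgue)
        (\<lambda>z. indicator (grid_cell N a \<times> grid_cell N a) z * gagliardo_quotient s w w z)" for a
      by (rule Bochner_Integration.integrable_bound[OF X0_D(3)[OF w]])
         (auto simp del: split_paired_All intro!: AE_I2 split: split_indicator)
    have "(\<Sum>a\<in>?I. ?D a) = (LINT z|(lebesgue \<Otimes>\<^sub>M lebesgue).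
        (\<Sum>a\<in>?I. indicator (grid_cell N a \<times> grid_cell N a) z * gagliardo_quotient s w w z))"
      by (rule Bochner_Integration.integral_sum[symmetric]) (rule int)
    also have "\<dots> \<le> gagliardo_form s w w"
      unfolding gagliardo_form_def
    proof (rule integral_mono)
      fix z :: "(real^'n) \<times> (real^'n)"
      have "(\<Sum>a\<in>?I. indicator (grid_cell N a \<times> grid_cell N a) z * gagliardo_quotient s w w z)
          \<le> (\<Sum>a\<in>?I. indicator (grid_cell N a) (fst z) * gagliardo_quotient s w w z)"
        by (intro sum_mono mult_right_mono gagliardo_quotient_nonneg) (auto simp: indicator_def)
      also have "\<dots> \<le> gagliardo_quotient s w w z"
        unfolding one_cell using gagliardo_quotient_nonneg[of s w z] by simp
      finally show "(\<Sum>a\<in>?I. indicator (grid_cell N a \<times> grid_cell N a) z * gagliardo_quotient s w w z)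
          \<le> gagliardo_quotient s w w z" .
    qed (use int X0_D(3)[OF w] in auto)
    finally show ?thesis .
  qed
  finally show ?thesis by (simp add: mult_left_mono)
qed

text \<open>Fatou's lemma in the form used throughout: bounds on real integrals pass to the limit, and
  integrability of the limit is part of the conclusion.\<close>

lemma integral_Fatou:
  fixes g :: "nat \<Rightarrow> 'a \<Rightarrow> real"
  assumes int: "\<And>n. integrable M (g n)" and nonneg: "\<And>n. AE x in M. 0 \<le> g n x"
    and meas: "g' \<in> borel_measurable M" and AE: "AE x in M. (\<lambda>n. g n x) \<longlonglongrightarrow> g' x"
    and bound: "\<And>n. (LINT x|M. g n x) \<le> a n" and a: "a \<longlonglongrightarrow> l"
  shows "integrable M g'" "(LINT x|M. g' x) \<le> l"
proof -
  have "AE x in M. \<forall>n. 0 \<le> g n x"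
    unfolding AE_all_countable using nonneg by blast
  with AE have nonneg': "AE x in M. 0 \<le> g' x"
    by eventually_elim (auto intro: LIMSEQ_le_const)
  have "(\<integral>\<^sup>+x. ennreal (g' x) \<partial>M) = (\<integral>\<^sup>+x. liminf (\<lambda>n. ennreal (g n x)) \<partial>M)"
  proof (rule nn_integral_cong_AE)
    show "AE x in M. ennreal (g' x) = liminf (\<lambda>n. ennreal (g n x))"
      using AE by eventually_elim (intro lim_imp_Liminf[symmetric] tendsto_ennrealI, auto)
  qed
  also have "\<dots> \<le> liminf (\<lambda>n. \<integral>\<^sup>+x. ennreal (g n x) \<partial>M)"
    using int by (intro nn_integral_liminf) auto
  also have "\<dots> \<le> liminf (\<lambda>n. ennreal (a n))"
  proof (intro Liminf_mono always_eventually allI)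
    fix n
    show "(\<integral>\<^sup>+x. ennreal (g n x) \<partial>M) \<le> ennreal (a n)"
      using bound[of n] by (subst nn_integral_eq_integral[OF int nonneg]) (rule ennreal_leI)
  qed
  also have "\<dots> = ennreal l"
    by (intro lim_imp_Liminf tendsto_ennrealI a) auto
  finally have le: "(\<integral>\<^sup>+x. ennreal (g' x) \<partial>M) \<le> ennreal l" .
  show int': "integrable M g'"
    using le by (intro integrableI_nonneg meas nonneg') (auto simp: le_less_trans)
  have "0 \<le> (LINT x|M. g n x)" for n
    using nonneg by (rule integral_nonneg_AE)
  then have "0 \<le> a n" for n using bound order_trans by blast
  then have "0 \<le> l" using a by (intro LIMSEQ_le_const) auto
  then show "(LINT x|M. g' x) \<le> l"
    using le by (subst (asm) nn_integral_eq_integral[OF int' nonneg']) auto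
qed

lemma bounded_families_diagonal:
  fixes c :: "nat \<Rightarrow> 'i::countable \<Rightarrow> real"
  assumes "\<And>i. Bseq (\<lambda>n. c n i)"
  obtains r :: "nat \<Rightarrow> nat" where "strict_mono r" "\<And>i. convergent (\<lambda>k. c (r k) i)"
proof -
  let ?P = "\<lambda>m (r::nat \<Rightarrow> nat). convergent (\<lambda>k. c (r k) (from_nat m))"
  interpret subseqs ?P
  proof
    fix m and r :: "nat \<Rightarrow> nat" assume "strict_mono r"
    have "bounded (range (\<lambda>k. c (r k) (from_nat m)))"
      using assms[of "from_nat m"] unfolding Bseq_eq_bounded
      by (rule bounded_subset) auto
    then obtain l r' where "strict_mono r'" "((\<lambda>k. c (r k) (from_nat m)) \<circ> r') \<longlonglongrightarrow> l"
      using bounded_imp_convergent_subsequence by blast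
    then show "\<exists>r'. strict_mono r' \<and> convergent (\<lambda>k. c ((r \<circ> r') k) (from_nat m))"
      by (auto simp: convergent_def o_def)
  qed
  have "convergent (\<lambda>k. c (diagseq k) i)" for i
  proof -
    have "?P (to_nat i) (diagseq \<circ> (+) (Suc (to_nat i)))"
    proof (rule diagseq_holds)
      fix m and r r' :: "nat \<Rightarrow> nat" assume "strict_mono r'" "?P m r"
      then show "?P m (r \<circ> r')"
        unfolding convergent_def using LIMSEQ_subseq_LIMSEQ[OF _ \<open>strict_mono r'\<close>] by (fastforce simp: o_def)
    qed
    then have "convergent (\<lambda>k. c (diagseq (k + Suc (to_nat i))) i)"
      by (simp add: o_def add.commute)
    then show ?thesis
      by (rule convergent_ignore_initial_segment[THEN iffD1])
  qed
  then show thesis using that subseq_diagseq by blast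
qed

text \<open>Along a diagonal subsequence all cell integrals converge, so by the grid inequality differences
  of late members are small in \<open>L\<^sup>2\<close>.\<close>

lemma X0_totally_bounded:
  fixes u :: "nat \<Rightarrow> real^'n \<Rightarrow> real"
  assumes u: "\<And>n. u n \<in> X0 s \<Omega>" and s: "0 < s" and \<Omega>: "bounded \<Omega>"
    and E: "\<And>n. gagliardo_form s (u n) (u n) \<le> M"
    and B: "\<And>n. integrable lebesgue (u n)" "\<And>n. (LINT x|lebesgue. \<bar>u n x\<bar>) \<le> B"
  obtains r :: "nat \<Rightarrow> nat" where "strict_mono r"
    "\<And>\<epsilon>. 0 < \<epsilon> \<Longrightarrow> \<exists>K. \<forall>j\<ge>K. \<forall>k\<ge>K. (LINT x|lebesgue. (u (r j) x - u (r k) x)\<^sup>2) < \<epsilon>"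
proof -
  note [measurable] = X0_D(1)[OF u]
  define c where "c n = (\<lambda>(N, a). LINT x|lebesgue. indicator (grid_cell (Suc N) a) x * u n x)"
    for n and Na :: "nat \<times> ('n \<Rightarrow> int)"
  have [measurable]: "grid_cell (Suc N) a \<in> sets lebesgue" for N and a :: "'n \<Rightarrow> int"
    using grid_cell_lmeasurable[of "Suc N" a] by auto
  have int: "integrable lebesgue (\<lambda>x. indicator (grid_cell (Suc N) a) x * u n x)" for N a n
    by (rule Bochner_Integration.integrable_bound[OF B(1)[of n]]) (auto split: split_indicator)
  have "\<bar>c n Na\<bar> \<le> B" for n Na
  proof -
    have "\<bar>LINT x|lebesgue. indicator (grid_cell (Suc N) a) x * u n x\<bar> \<le> (LINT x|lebesgue. \<bar>u n x\<bar>)" for N a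
    proof -
      have "\<bar>LINT x|lebesgue. indicator (grid_cell (Suc N) a) x * u n x\<bar>
          \<le> (LINT x|lebesgue. \<bar>indicator (grid_cell (Suc N) a) x * u n x\<bar>)"
        by (rule integral_abs_bound)
      also have "\<dots> \<le> (LINT x|lebesgue. \<bar>u n x\<bar>)"
        by (intro integral_mono integrable_abs int B(1)) (auto split: split_indicator)
      finally show ?thesis .
    qed
    then show ?thesis using B(2)[of n] by (cases Na) (auto simp: c_def intro: order_trans)
  qed
  then have "Bseq (\<lambda>n. c n Na)" for Na by (intro BseqI'[of _ B]) simp
  then obtain r where r: "strict_mono r" "\<And>Na. convergent (\<lambda>k. c (r k) Na)"
    using bounded_families_diagonal by blast
  have "\<exists>K. \<forall>j\<ge>K. \<forall>k\<ge>K. (LINT x|lebesgue. (u (r j) x - u (r k) x)\<^sup>2) < \<epsilon>" if "0 < \<epsilon>" for \<epsilon>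
  proof -
    \<comment> \<open>The differences have energy at most \<open>4 * M\<close>; refine the grid until their oscillation is at most \<open>\<epsilon> / 2\<close>.\<close>
    define C where "C = real CARD('n) powr (real CARD('n) + 2 * s) * (4 * M)"
    have "(\<lambda>N. real N powr (- 2 * s)) \<longlonglongrightarrow> 0"
      using s by (intro tendsto_neg_powr filterlim_real_sequentially) simp
    then have "(\<lambda>N. C * real (Suc N) powr (- 2 * s)) \<longlonglongrightarrow> C * 0"
      by (rule tendsto_mult[OF tendsto_const LIMSEQ_Suc])
    then have "\<forall>\<^sub>F N in sequentially. C * real (Suc N) powr (- 2 * s) < \<epsilon> / 2"
      using \<open>0 < \<epsilon>\<close> by (intro order_tendstoD) auto
    then obtain N where N: "C * real (Suc N) powr (- 2 * s) < \<epsilon> / 2"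
      by (auto simp: eventually_sequentially)
    let ?I = "grid_indices \<Omega> (Suc N)"
    define l where "l a = lim (\<lambda>k. c (r k) (N, a))" for a
    have l: "(\<lambda>k. c (r k) (N, a)) \<longlonglongrightarrow> l a" for a
      using r(2)[of "(N, a)"] unfolding l_def convergent_LIMSEQ_iff .
    have "(\<lambda>k. real (Suc N) ^ CARD('n) * (\<Sum>a\<in>?I. (c (r k) (N, a) - l a)\<^sup>2))
        \<longlonglongrightarrow> real (Suc N) ^ CARD('n) * (\<Sum>a\<in>?I. (l a - l a)\<^sup>2)"
      by (intro tendsto_intros l)
    moreover have "real (Suc N) ^ CARD('n) * (\<Sum>a\<in>?I. (l a - l a)\<^sup>2) < \<epsilon> / 8"
      using \<open>0 < \<epsilon>\<close> by simp
    ultimately have "\<forall>\<^sub>F k in sequentially. real (Suc N) ^ CARD('n) * (\<Sum>a\<in>?I. (c (r k) (N, a) - l a)\<^sup>2) < \<epsilon> / 8"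
      by (rule order_tendstoD(2))
    then obtain K where K: "\<And>k. k \<ge> K \<Longrightarrow> real (Suc N) ^ CARD('n) * (\<Sum>a\<in>?I. (c (r k) (N, a) - l a)\<^sup>2) < \<epsilon> / 8"
      by (auto simp: eventually_sequentially)
    show ?thesis
    proof (intro exI[of _ K] allI impI)
      fix j k assume jk: "j \<ge> K" "k \<ge> K"
      let ?w = "\<lambda>x. u (r j) x - u (r k) x"
      have w: "?w \<in> X0 s \<Omega>" by (intro X0_diff u)
      have "gagliardo_form s ?w ?w \<le> 2 * gagliardo_form s (u (r j)) (u (r j)) + 2 * gagliardo_form s (\<lambda>x. (-1) * u (r k) x) (\<lambda>x. (-1) * u (r k) x)"
        using gagliardo_form_add_le[OF u[of "r j"] X0_scale[OF u[of "r k"], of "-1"], of 1] by simp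
      also have "\<dots> \<le> 4 * M"
        using E[of "r j"] E[of "r k"] unfolding gagliardo_form_scale by simp
      finally have Ew: "gagliardo_form s ?w ?w \<le> 4 * M" .
      have cw: "(LINT x|lebesgue. indicator (grid_cell (Suc N) a) x * ?w x) = c (r j) (N, a) - c (r k) (N, a)" for a
        using int[of N a "r j"] int[of N a "r k"] by (simp add: c_def right_diff_distrib)
      have "(\<Sum>a\<in>?I. (c (r j) (N, a) - c (r k) (N, a))\<^sup>2)
          \<le> (\<Sum>a\<in>?I. 2 * (c (r j) (N, a) - l a)\<^sup>2 + 2 * (c (r k) (N, a) - l a)\<^sup>2)"
      proof (rule sum_mono)
        fix a
        show "(c (r j) (N, a) - c (r k) (N, a))\<^sup>2 \<le> 2 * (c (r j) (N, a) - l a)\<^sup>2 + 2 * (c (r k) (N, a) - l a)\<^sup>2"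
          using zero_le_power2[of "c (r j) (N, a) - l a + (c (r k) (N, a) - l a)"]
          by (simp add: power2_eq_square algebra_simps)
      qed
      then have "real (Suc N) ^ CARD('n) * (\<Sum>a\<in>?I. (c (r j) (N, a) - c (r k) (N, a))\<^sup>2)
          \<le> real (Suc N) ^ CARD('n) * (\<Sum>a\<in>?I. 2 * (c (r j) (N, a) - l a)\<^sup>2 + 2 * (c (r k) (N, a) - l a)\<^sup>2)"
        by (rule mult_left_mono) simp
      also have "\<dots> = 2 * (real (Suc N) ^ CARD('n) * (\<Sum>a\<in>?I. (c (r j) (N, a) - l a)\<^sup>2))
          + 2 * (real (Suc N) ^ CARD('n) * (\<Sum>a\<in>?I. (c (r k) (N, a) - l a)\<^sup>2))"
        by (simp only: sum.distrib sum_distrib_left[symmetric] distrib_left mult.left_commute)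
      also have "\<dots> < \<epsilon> / 2" using K[OF jk(1)] K[OF jk(2)] by linarith
      finally have 1: "real (Suc N) ^ CARD('n) * (\<Sum>a\<in>?I. (c (r j) (N, a) - c (r k) (N, a))\<^sup>2) < \<epsilon> / 2" .
      have "real CARD('n) powr (real CARD('n) + 2 * s) * real (Suc N) powr (- 2 * s) * gagliardo_form s ?w ?w
          \<le> real CARD('n) powr (real CARD('n) + 2 * s) * real (Suc N) powr (- 2 * s) * (4 * M)"
        by (intro mult_left_mono Ew) auto
      also have "\<dots> < \<epsilon> / 2" using N by (simp add: C_def mult_ac)
      finally have 2: "real CARD('n) powr (real CARD('n) + 2 * s) * real (Suc N) powr (- 2 * s) * gagliardo_form s ?w ?w < \<epsilon> / 2" .
      show "(LINT x|lebesgue. (?w x)\<^sup>2) < \<epsilon>"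
        using grid_poincare[OF w less_imp_le[OF s] \<Omega>, of "Suc N"] 1 2 unfolding cw by linarith
    qed
  qed
  then show thesis using that r(1) by blast
qed

text \<open>Passing to a subsequence with summably small consecutive \<open>L\<^sup>2\<close> distances gives almost everywhere
  convergence. The bound \<open>\<bar>t\<bar> \<le> 1 / 2 ^ k + 2 ^ k * t\<^sup>2\<close> turns summability of weighted squares into
  summability of absolute values, also on a space of infinite measure.\<close>

lemma L2_Cauchy_subsequence:
  fixes u :: "nat \<Rightarrow> 'a \<Rightarrow> real"
  assumes [measurable]: "\<And>n. u n \<in> borel_measurable M"
    and int: "\<And>j k. integrable M (\<lambda>x. (u j x - u k x)\<^sup>2)"
    and Cauchy: "\<And>\<epsilon>. 0 < \<epsilon> \<Longrightarrow> \<exists>K. \<forall>j\<ge>K. \<forall>k\<ge>K. (LINT x|M. (u j x - u k x)\<^sup>2) < \<epsilon>"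
  obtains r :: "nat \<Rightarrow> nat" and v where "strict_mono r" "v \<in> borel_measurable M" "AE x in M. (\<lambda>k. u (r k) x) \<longlonglongrightarrow> v x"
    "\<And>k. integrable M (\<lambda>x. (u (r k) x - v x)\<^sup>2)" "(\<lambda>k. LINT x|M. (u (r k) x - v x)\<^sup>2) \<longlonglongrightarrow> 0"
proof -
  have "\<exists>K. \<forall>j\<ge>K. \<forall>k\<ge>K. (LINT x|M. (u j x - u k x)\<^sup>2) < (1/4) ^ m" for m :: nat
    by (rule Cauchy) simp
  then obtain K where K: "\<And>m j k. j \<ge> K m \<Longrightarrow> k \<ge> K m \<Longrightarrow> (LINT x|M. (u j x - u k x)\<^sup>2) < (1/4) ^ m"
    by metis
  have "\<exists>r. \<forall>m. r m \<ge> K m \<and> r m < r (Suc m)"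
  proof (rule dependent_nat_choice)
    show "\<exists>y. K (Suc m) \<le> y \<and> x < y" for x m
      by (intro exI[of _ "max (Suc x) (K (Suc m))"]) auto
  qed blast
  then obtain r where r: "\<And>m. r m \<ge> K m" "strict_mono r"
    by (auto simp: strict_mono_Suc_iff)
  have close: "(LINT x|M. (u (r m) x - u (r k) x)\<^sup>2) < (1/4) ^ m" if "m \<le> k" for m k
    using K[of m "r m" "r k"] r(1)[of m] strict_mono_less_eq[OF r(2), of m k] that by (meson order_trans)
  define v where "v x = lim (\<lambda>k. u (r k) x)" for x
  have [measurable]: "v \<in> borel_measurable M"
    unfolding v_def by measurable
  let ?d = "\<lambda>k x. u (r (Suc k)) x - u (r k) x"
  have "(\<integral>\<^sup>+x. (\<Sum>k. ennreal (2 ^ k * (?d k x)\<^sup>2)) \<partial>M) = (\<Sum>k. \<integral>\<^sup>+x. ennreal (2 ^ k * (?d k x)\<^sup>2) \<partial>M)"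
    by (rule nn_integral_suminf) measurable
  also have "\<dots> \<le> (\<Sum>k. ennreal ((1/2) ^ k))"
  proof (rule suminf_le)
    fix k
    have "(\<integral>\<^sup>+x. ennreal (2 ^ k * (?d k x)\<^sup>2) \<partial>M) = ennreal (2 ^ k * (LINT x|M. (?d k x)\<^sup>2))"
      using int by (subst nn_integral_eq_integral) auto
    also have "(LINT x|M. (?d k x)\<^sup>2) = (LINT x|M. (u (r k) x - u (r (Suc k)) x)\<^sup>2)"
      by (simp add: power2_commute)
    also have "2 ^ k * \<dots> \<le> (2::real) ^ k * (1/4) ^ k"
      by (intro mult_left_mono less_imp_le close) auto
    also have "\<dots> = (1/2) ^ k" by (simp add: power_mult_distrib[symmetric])
    finally show "(\<integral>\<^sup>+x. ennreal (2 ^ k * (?d k x)\<^sup>2) \<partial>M) \<le> ennreal ((1/2) ^ k)"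
      by (simp add: ennreal_leI)
  qed auto
  also have "\<dots> = ennreal (\<Sum>k. (1/2) ^ k)"
    by (rule suminf_ennreal_eq) (auto intro!: summable_sums summable_geometric)
  finally have "(\<integral>\<^sup>+x. (\<Sum>k. ennreal (2 ^ k * (?d k x)\<^sup>2)) \<partial>M) \<noteq> \<infinity>"
    by (auto simp: top_unique)
  then have "AE x in M. (\<Sum>k. ennreal (2 ^ k * (?d k x)\<^sup>2)) \<noteq> \<infinity>"
    by (intro nn_integral_PInf_AE) auto
  then have AE: "AE x in M. (\<lambda>k. u (r k) x) \<longlonglongrightarrow> v x"
  proof eventually_elim
    case (elim x)
    then have "summable (\<lambda>k. 2 ^ k * (?d k x)\<^sup>2)"
      by (intro summable_suminf_not_top) auto
    moreover have "summable (\<lambda>k. (1/2::real) ^ k)" by (rule summable_geometric) simp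
    ultimately have "summable (\<lambda>k. (1/2) ^ k + 2 ^ k * (?d k x)\<^sup>2)" by (intro summable_add)
    then have "summable (\<lambda>k. ?d k x)"
    proof (rule summable_comparison_test'[where N = 0], goal_cases)
      case (1 k)
      have "\<bar>t\<bar> \<le> 1 / b + b * t\<^sup>2" if "b > 0" for t b :: real
      proof -
        have "0 \<le> (b * \<bar>t\<bar> - 1)\<^sup>2" by simp
        then have "\<bar>t\<bar> * b * 2 \<le> 1 + b\<^sup>2 * t\<^sup>2" by (simp add: power2_eq_square algebra_simps)
        moreover have "0 \<le> \<bar>t\<bar> * b" using that by simp
        ultimately have "\<bar>t\<bar> * b \<le> 1 + b\<^sup>2 * t\<^sup>2" by linarith
        then show ?thesis using that by (simp add: field_simps power2_eq_square)
      qed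
      from this[of "2 ^ k" "?d k x"] show ?case by (simp add: power_one_over)
    qed
    then have "(\<lambda>n. \<Sum>k<n. ?d k x) \<longlonglongrightarrow> (\<Sum>k. ?d k x)" by (rule summable_LIMSEQ)
    then have "(\<lambda>n. u (r n) x - u (r 0) x) \<longlonglongrightarrow> (\<Sum>k. ?d k x)"
      by (simp only: sum_lessThan_telescope[of "\<lambda>k. u (r k) x"])
    then have "(\<lambda>n. u (r n) x - u (r 0) x + u (r 0) x) \<longlonglongrightarrow> (\<Sum>k. ?d k x) + u (r 0) x"
      by (intro tendsto_add tendsto_const)
    then have "convergent (\<lambda>n. u (r n) x)" by (auto simp: convergent_def)
    then show ?case by (simp add: v_def convergent_LIMSEQ_iff)
  qed
  have int_v: "integrable M (\<lambda>x. (u (r m) x - v x)\<^sup>2)"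
    and le: "(LINT x|M. (u (r m) x - v x)\<^sup>2) \<le> (1/4) ^ m" for m
  proof -
    have "AE x in M. (\<lambda>k. (u (r m) x - u (r (m + k)) x)\<^sup>2) \<longlonglongrightarrow> (u (r m) x - v x)\<^sup>2"
      using AE
    proof eventually_elim
      case (elim x)
      then have "(\<lambda>k. u (r (m + k)) x) \<longlonglongrightarrow> v x"
        by (subst add.commute) (rule LIMSEQ_ignore_initial_segment)
      then show ?case by (intro tendsto_intros)
    qed
    note Fatou = integral_Fatou[OF int _ _ this, of "\<lambda>_. (1/4) ^ m" "(1/4) ^ m"]
    show "integrable M (\<lambda>x. (u (r m) x - v x)\<^sup>2)" "(LINT x|M. (u (r m) x - v x)\<^sup>2) \<le> (1/4) ^ m"
      by (rule Fatou; use close[of m] in \<open>simp add: less_imp_le\<close>)+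
  qed
  then have "(\<lambda>k. LINT x|M. (u (r k) x - v x)\<^sup>2) \<longlonglongrightarrow> 0"
    by (intro tendsto_sandwich[OF _ _ tendsto_const LIMSEQ_realpow_zero[of "1/4"]])
       (auto intro!: always_eventually)
  then show thesis
    by (rule that[OF r(2) \<open>v \<in> borel_measurable M\<close> AE int_v])
qed

text \<open>Almost everywhere convergence on the space carries over to the product, since a null set times
  the whole space is null; Fatou's lemma there gives lower semicontinuity.\<close>

lemma gagliardo_form_lsc:
  fixes u :: "nat \<Rightarrow> real^'n \<Rightarrow> real"
  assumes u: "\<And>n. u n \<in> X0 s \<Omega>" and [measurable]: "v \<in> borel_measurable lebesgue"
    and AE: "AE x in lebesgue. (\<lambda>n. u n x) \<longlonglongrightarrow> v x"
    and v2: "integrable lebesgue (\<lambda>x. (v x)\<^sup>2)"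
    and L: "(\<lambda>n. gagliardo_form s (u n) (u n)) \<longlonglongrightarrow> L"
  shows "v \<in> X0 s \<Omega>" "gagliardo_form s v v \<le> L"
proof -
  note [measurable] = X0_D(1)[OF u]
  let ?M = "lebesgue \<Otimes>\<^sub>M lebesgue :: ((real^'n) \<times> (real^'n)) measure"
  obtain N where N: "\<And>x. x \<in> space lebesgue - N \<Longrightarrow> (\<lambda>n. u n x) \<longlonglongrightarrow> v x" "N \<in> null_sets lebesgue"
    by (rule AE_E3[OF AE]) (rule that; assumption)
  have "N \<times> UNIV \<in> null_sets ?M" "UNIV \<times> N \<in> null_sets ?M"
    using N(2) by auto
  then have null: "N \<times> UNIV \<union> UNIV \<times> N \<in> null_sets ?M" by (rule null_sets.Un)
  have AEp: "AE z in ?M. (\<lambda>n. gagliardo_quotient s (u n) (u n) z) \<longlonglongrightarrow> gagliardo_quotient s v v z"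
  proof (rule AE_I'[OF null], safe)
    fix x y assume neg: "\<not> (\<lambda>n. gagliardo_quotient s (u n) (u n) (x, y)) \<longlonglongrightarrow> gagliardo_quotient s v v (x, y)"
      and "y \<notin> N"
    show "x \<in> N"
    proof (rule ccontr)
      assume "x \<notin> N"
      then have "(\<lambda>n. u n x) \<longlonglongrightarrow> v x" "(\<lambda>n. u n y) \<longlonglongrightarrow> v y"
        using N(1) \<open>y \<notin> N\<close> by auto
      then have "(\<lambda>n. (u n x - u n y) * (u n x - u n y) * inverse (norm (x - y) powr (real CARD('n) + 2 * s)))
          \<longlonglongrightarrow> (v x - v y) * (v x - v y) * inverse (norm (x - y) powr (real CARD('n) + 2 * s))"
        by (intro tendsto_intros)
      then show False using neg by (simp add: gagliardo_quotient_def divide_inverse)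
    qed
  qed auto
  note Fatou = integral_Fatou[OF X0_D(3)[OF u] AE_I2[OF gagliardo_quotient_nonneg] _ AEp _ L]
  have int: "integrable ?M (gagliardo_quotient s v v)"
    by (rule Fatou) (auto simp: gagliardo_form_def)
  show "gagliardo_form s v v \<le> L"
    unfolding gagliardo_form_def by (rule Fatou) (auto simp: gagliardo_form_def)
  have "AE x in lebesgue. \<forall>n. x \<notin> \<Omega> \<longrightarrow> u n x = 0"
    unfolding AE_all_countable using X0_D(4)[OF u] by blast
  with AE have "AE x in lebesgue. x \<notin> \<Omega> \<longrightarrow> v x = 0"
    by eventually_elim (auto simp: LIMSEQ_const_iff)
  then show "v \<in> X0 s \<Omega>" using int v2 by (simp add: X0_def frac_sobolev_def)
qed

text \<open>The form of Rellich's theorem that the direct method needs. Assuming that the forms converge is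
  no loss, as a bounded sequence of reals has a convergent subsequence.\<close>

lemma X0_compact:
  fixes u :: "nat \<Rightarrow> real^'n \<Rightarrow> real"
  assumes u: "\<And>n. u n \<in> X0 s \<Omega>" and s: "0 < s" and \<Omega>: "bounded \<Omega>"
    and E: "(\<lambda>n. gagliardo_form s (u n) (u n)) \<longlonglongrightarrow> L"
    and B: "\<And>n. integrable lebesgue (u n)" "\<And>n. (LINT x|lebesgue. \<bar>u n x\<bar>) \<le> B"
  obtains r :: "nat \<Rightarrow> nat" and v where "strict_mono r" "v \<in> X0 s \<Omega>" "gagliardo_form s v v \<le> L"
    "AE x in lebesgue. (\<lambda>k. u (r k) x) \<longlonglongrightarrow> v x"
    "(\<lambda>k. LINT x|lebesgue. (u (r k) x - v x)\<^sup>2) \<longlonglongrightarrow> 0"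
proof -
  obtain M where "\<And>n. \<bar>gagliardo_form s (u n) (u n)\<bar> \<le> M"
    using convergent_imp_Bseq[of "\<lambda>n. gagliardo_form s (u n) (u n)"] E by (auto simp: convergent_def Bseq_def)
  then have M: "gagliardo_form s (u n) (u n) \<le> M" for n by (meson abs_le_D1)
  obtain r :: "nat \<Rightarrow> nat" where r: "strict_mono r"
    "\<And>\<epsilon>. 0 < \<epsilon> \<Longrightarrow> \<exists>K. \<forall>j\<ge>K. \<forall>k\<ge>K. (LINT x|lebesgue. (u (r j) x - u (r k) x)\<^sup>2) < \<epsilon>"
    by (rule X0_totally_bounded[OF u s \<Omega> M B]) (rule that; assumption)
  obtain r' :: "nat \<Rightarrow> nat" and v where r': "strict_mono r'" "v \<in> borel_measurable lebesgue"
      "AE x in lebesgue. (\<lambda>k. u (r (r' k)) x) \<longlonglongrightarrow> v x"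
      "\<And>k. integrable lebesgue (\<lambda>x. (u (r (r' k)) x - v x)\<^sup>2)"
      "(\<lambda>k. LINT x|lebesgue. (u (r (r' k)) x - v x)\<^sup>2) \<longlonglongrightarrow> 0"
  proof (rule L2_Cauchy_subsequence[of "\<lambda>k. u (r k)" lebesgue])
    show "\<And>n. u (r n) \<in> borel_measurable lebesgue" by (rule X0_D(1)[OF u])
    show "\<And>j k. integrable lebesgue (\<lambda>x. (u (r j) x - u (r k) x)\<^sup>2)" by (rule X0_D(2)[OF X0_diff[OF u u]])
    show "\<And>\<epsilon>. 0 < \<epsilon> \<Longrightarrow> \<exists>K. \<forall>j\<ge>K. \<forall>k\<ge>K. (LINT x|lebesgue. (u (r j) x - u (r k) x)\<^sup>2) < \<epsilon>" by (rule r(2))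
  qed (rule that; assumption)
  note [measurable] = X0_D(1)[OF u] r'(2)
  have v2: "integrable lebesgue (\<lambda>x. (v x)\<^sup>2)"
  proof (rule Bochner_Integration.integrable_bound)
    show "integrable lebesgue (\<lambda>x. 2 * (u (r (r' 0)) x)\<^sup>2 + 2 * (u (r (r' 0)) x - v x)\<^sup>2)"
      using X0_D(2)[OF u] r'(4) by simp
    have "b\<^sup>2 \<le> 2 * a\<^sup>2 + 2 * (a - b)\<^sup>2" for a b :: real
      using zero_le_power2[of "2 * a - b"] by (simp add: power2_eq_square algebra_simps)
    then show "AE x in lebesgue. norm ((v x)\<^sup>2) \<le> norm (2 * (u (r (r' 0)) x)\<^sup>2 + 2 * (u (r (r' 0)) x - v x)\<^sup>2)"
      by (intro AE_I2) simp
  qed measurable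
  have rr: "strict_mono (r \<circ> r')" using r(1) r'(1) by (rule strict_mono_o)
  have "(\<lambda>k. gagliardo_form s (u (r (r' k))) (u (r (r' k)))) \<longlonglongrightarrow> L"
    using LIMSEQ_subseq_LIMSEQ[OF E rr] by (simp add: o_def)
  from gagliardo_form_lsc[of "\<lambda>k. u (r (r' k))", OF u r'(2,3) v2 this]
  show thesis using that[OF rr] r'(3,5) by (simp add: o_def)
qed

section \<open>The first eigenvalue\<close>

lemma finite_measure_lebesgue_on: "S \<in> lmeasurable \<Longrightarrow> finite_measure (lebesgue_on S)"
  by (intro finite_measureI) (auto simp: emeasure_restrict_space fmeasurable_def simp del: emeasure_completion)

lemma X0_borel_measurable_on:
  "u \<in> X0 s \<Omega> \<Longrightarrow> u \<in> borel_measurable (lebesgue_on \<Omega>)"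
  by (intro measurable_restrict_space1 X0_D(1))

lemma
  assumes u: "u \<in> X0 s \<Omega>" and \<Omega>: "\<Omega> \<in> sets lebesgue"
    and g: "g \<in> borel_measurable borel" "g 0 = (0::real)"
  shows X0_integral_restrict: "(LINT x|lebesgue_on \<Omega>. g (u x)) = (LINT x|lebesgue. g (u x))"
    and X0_integrable_restrict: "integrable (lebesgue_on \<Omega>) (\<lambda>x. g (u x)) \<longleftrightarrow> integrable lebesgue (\<lambda>x. g (u x))"
proof -
  note [measurable] = X0_D(1)[OF u] g(1) \<Omega>
  have AE: "AE x in lebesgue. indicator \<Omega> x *\<^sub>R g (u x) = g (u x)"
    using X0_D(4)[OF u] by eventually_elim (auto simp: g(2) indicator_def)
  show "(LINT x|lebesgue_on \<Omega>. g (u x)) = (LINT x|lebesgue. g (u x))"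
    using \<Omega> integral_cong_AE[OF _ _ AE] by (simp add: integral_restrict_space)
  show "integrable (lebesgue_on \<Omega>) (\<lambda>x. g (u x)) \<longleftrightarrow> integrable lebesgue (\<lambda>x. g (u x))"
    using \<Omega> integrable_cong_AE[OF _ _ AE] by (simp add: integrable_restrict_space)
qed

lemma X0_integrable:
  assumes u: "u \<in> X0 s \<Omega>" and \<Omega>: "\<Omega> \<in> lmeasurable"
  shows "integrable lebesgue u"
proof (rule Bochner_Integration.integrable_bound)
  show "integrable lebesgue (\<lambda>x. indicator \<Omega> x + (u x)\<^sup>2)"
    using \<Omega> by (intro Bochner_Integration.integrable_add X0_D(2)[OF u])
      (simp add: fmeasurable_def del: emeasure_completion)
  have *: "\<bar>t\<bar> \<le> 1 + t\<^sup>2" for t :: real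
    using zero_le_power2[of "\<bar>t\<bar> - 1"] by (simp add: power2_eq_square algebra_simps)
  show "AE x in lebesgue. norm (u x) \<le> norm (indicator \<Omega> x + (u x)\<^sup>2)"
    using X0_D(4)[OF u] by eventually_elim (use * in \<open>auto simp: indicator_def\<close>)
qed (use X0_D(1)[OF u] in simp)

text \<open>Members of \<open>X0\<close> vanish outside a set of finite measure, so any power integral controls the
  \<open>L\<^sup>1\<close> norm that the compactness theorem asks for.\<close>

lemma X0_L1_bound:
  assumes u: "u \<in> X0 s \<Omega>" and \<Omega>: "\<Omega> \<in> lmeasurable"
    and q: "1 \<le> q" and int: "integrable (lebesgue_on \<Omega>) (\<lambda>x. \<bar>u x\<bar> powr q)"
  shows "(LINT x|lebesgue. \<bar>u x\<bar>) \<le> measure lebesgue \<Omega> + (LINT x|lebesgue_on \<Omega>. \<bar>u x\<bar> powr q)"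
proof -
  interpret finite_measure "lebesgue_on \<Omega>" by (rule finite_measure_lebesgue_on[OF \<Omega>])
  have \<Omega>': "\<Omega> \<in> sets lebesgue" using \<Omega> by auto
  have *: "\<bar>t\<bar> \<le> 1 + \<bar>t\<bar> powr q" for t :: real
  proof (cases "\<bar>t\<bar> \<le> 1")
    case False
    then show ?thesis using powr_mono[of 1 q "\<bar>t\<bar>"] q by simp
  next
    case True
    moreover have "0 \<le> \<bar>t\<bar> powr q" by simp
    ultimately show ?thesis by linarith
  qed
  have "(LINT x|lebesgue. \<bar>u x\<bar>) = (LINT x|lebesgue_on \<Omega>. \<bar>u x\<bar>)"
    by (rule X0_integral_restrict[OF u \<Omega>', of abs, symmetric]) auto
  also have "\<dots> \<le> (LINT x|lebesgue_on \<Omega>. 1 + \<bar>u x\<bar> powr q)"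
    using X0_integrable_restrict[OF u \<Omega>', of abs] X0_integrable[OF u \<Omega>] int *
    by (intro integral_mono) auto
  also have "\<dots> = measure lebesgue \<Omega> + (LINT x|lebesgue_on \<Omega>. \<bar>u x\<bar> powr q)"
    using int \<Omega>' by (simp add: measure_restrict_space)
  finally show ?thesis .
qed

lemma X0_nonzero_integral_pos:
  assumes "u \<in> X0 s \<Omega>" "\<Omega> \<in> sets lebesgue"
  shows "u \<in> X0_nonzero s \<Omega> \<longleftrightarrow> 0 < (LINT x|lebesgue_on \<Omega>. (u x)\<^sup>2)"
proof -
  have "(LINT x|lebesgue_on \<Omega>. (u x)\<^sup>2) = (LINT x|lebesgue. (u x)\<^sup>2)"
    by (rule X0_integral_restrict[OF assms]) auto
  moreover have "(LINT x|lebesgue. (u x)\<^sup>2) = 0 \<longleftrightarrow> (AE x in lebesgue. u x = 0)"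
    using X0_D(2)[OF assms(1)] by (subst integral_nonneg_eq_0_iff_AE) auto
  moreover have "0 \<le> (LINT x|lebesgue. (u x)\<^sup>2)" by simp
  ultimately show ?thesis using assms(1) by (auto simp: X0_nonzero_def less_le)
qed

text \<open>The first eigenvalue is defined as a least element, so the definition has content only once a
  minimizer of the Rayleigh quotient is found. For a minimizing sequence normalized in \<open>L\<^sup>2\<close>,
  \<open>L\<^sup>2\<close> convergence keeps the limit normalized, while lower semicontinuity bounds its form.\<close>

lemma first_eigenvalue_attained:
  fixes \<Omega> :: "(real^'n) set"
  assumes s: "0 < s" and \<Omega>: "\<Omega> \<in> lmeasurable" "bounded \<Omega>" and ne: "X0_nonzero s \<Omega> \<noteq> {}"
  obtains w where "w \<in> X0_nonzero s \<Omega>"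
    "gagliardo_form s w w = first_eigenvalue s \<Omega> * (LINT x|lebesgue_on \<Omega>. (w x)\<^sup>2)"
    "0 \<le> first_eigenvalue s \<Omega>"
proof -
  have \<Omega>': "\<Omega> \<in> sets lebesgue" using \<Omega> by auto
  let ?R = "\<lambda>u. (X0_norm s u)\<^sup>2 / (LINT x|lebesgue_on \<Omega>. (u x)\<^sup>2)"
  let ?S = "?R ` X0_nonzero s \<Omega>"
  define m where "m = Inf ?S"
  have bdd: "bdd_below ?S" by (intro bdd_belowI[of _ 0]) auto
  have m_le: "m \<le> ?R u" if "u \<in> X0_nonzero s \<Omega>" for u
    unfolding m_def using that bdd by (intro cInf_lower) auto
  have m0: "0 \<le> m" unfolding m_def using ne by (intro cInf_greatest) auto
  have "\<forall>n. \<exists>u. u \<in> X0_nonzero s \<Omega> \<and> ?R u < m + inverse (real (Suc n))"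
  proof
    fix n
    show "\<exists>u. u \<in> X0_nonzero s \<Omega> \<and> ?R u < m + inverse (real (Suc n))"
      using cInf_lessD[of ?S "m + inverse (real (Suc n))"] ne by (auto simp: m_def)
  qed
  then have "\<exists>u. \<forall>n. u n \<in> X0_nonzero s \<Omega> \<and> ?R (u n) < m + inverse (real (Suc n))"
    by (rule choice)
  then obtain u where u': "\<forall>n. u n \<in> X0_nonzero s \<Omega> \<and> ?R (u n) < m + inverse (real (Suc n))"
    by (rule exE)
  have u: "u n \<in> X0_nonzero s \<Omega>" "?R (u n) < m + inverse (real (Suc n))" for n
    by (fact conjunct1[OF spec[OF u']], fact conjunct2[OF spec[OF u']])
  have u0: "u n \<in> X0 s \<Omega>" for n using u(1)[of n] by (simp add: X0_nonzero_def)
  define v where "v n = (\<lambda>x. inverse (sqrt (LINT x|lebesgue_on \<Omega>. (u n x)\<^sup>2)) * u n x)" for n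
  have v: "v n \<in> X0 s \<Omega>" for n unfolding v_def by (rule X0_scale[OF u0])
  have pos: "0 < (LINT x|lebesgue_on \<Omega>. (u n x)\<^sup>2)" for n
    using X0_nonzero_integral_pos[OF u0 \<Omega>'] u(1) by blast
  have Ev: "gagliardo_form s (v n) (v n) = ?R (u n)" for n
    using pos[of n] by (simp add: v_def gagliardo_form_scale X0_norm_power2 power_inverse divide_inverse)
  have v1: "(LINT x|lebesgue. (v n x)\<^sup>2) = 1" for n
  proof -
    have "(LINT x|lebesgue. (v n x)\<^sup>2) = (LINT x|lebesgue_on \<Omega>. (v n x)\<^sup>2)"
      by (rule X0_integral_restrict[OF v \<Omega>', symmetric]) auto
    then show ?thesis
      using pos[of n] by (simp add: v_def power_mult_distrib power_inverse)
  qed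
  have lim: "(\<lambda>n. gagliardo_form s (v n) (v n)) \<longlonglongrightarrow> m"
    unfolding Ev
  proof (rule tendsto_sandwich)
    show "\<forall>\<^sub>F n in sequentially. m \<le> ?R (u n)"
      by (rule always_eventually, rule allI, rule m_le[OF u(1)])
    show "\<forall>\<^sub>F n in sequentially. ?R (u n) \<le> m + inverse (real (Suc n))"
      by (rule always_eventually, rule allI, rule less_imp_le[OF u(2)])
    show "(\<lambda>n. m + inverse (real (Suc n))) \<longlonglongrightarrow> m"
      using tendsto_add[OF tendsto_const[of m] LIMSEQ_inverse_real_of_nat] by simp
  qed (rule tendsto_const)
  have L1: "(LINT x|lebesgue. \<bar>v n x\<bar>) \<le> measure lebesgue \<Omega> + 1" for n
  proof -
    have sq: "\<bar>t\<bar> powr 2 = t\<^sup>2" for t :: real by simp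
    have "integrable (lebesgue_on \<Omega>) (\<lambda>x. (v n x)\<^sup>2)"
      using X0_integrable_restrict[OF v \<Omega>', of "\<lambda>t. t\<^sup>2"] X0_D(2)[OF v] by simp
    then have "(LINT x|lebesgue. \<bar>v n x\<bar>) \<le> measure lebesgue \<Omega> + (LINT x|lebesgue_on \<Omega>. (v n x)\<^sup>2)"
      using X0_L1_bound[OF v \<Omega>(1), of 2] unfolding sq by simp
    also have "(LINT x|lebesgue_on \<Omega>. (v n x)\<^sup>2) = 1"
      using X0_integral_restrict[OF v \<Omega>', of "\<lambda>t. t\<^sup>2"] v1 by simp
    finally show ?thesis .
  qed
  obtain r :: "nat \<Rightarrow> nat" and w where w: "w \<in> X0 s \<Omega>" "gagliardo_form s w w \<le> m"
    "(\<lambda>k. LINT x|lebesgue. (v (r k) x - w x)\<^sup>2) \<longlonglongrightarrow> 0"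
    by (rule X0_compact[OF v s \<Omega>(2) lim X0_integrable[OF v \<Omega>(1)] L1]) (rule that; assumption)
  define W where "W = (LINT x|lebesgue_on \<Omega>. (w x)\<^sup>2)"
  have W: "W = (LINT x|lebesgue. (w x)\<^sup>2)"
    unfolding W_def by (rule X0_integral_restrict[OF w(1) \<Omega>']) auto
  have "1 \<le> W"
  proof (rule field_le_epsilon)
    fix \<epsilon> :: real assume "0 < \<epsilon>"
    have "0 \<le> W" unfolding W by simp
    \<comment> \<open>A weight for Young's inequality that costs at most \<open>\<epsilon>\<close> in the term that survives in the limit.\<close>
    define \<eta> where "\<eta> = \<epsilon> / (W + 1)"
    have \<eta>: "0 < \<eta>" "\<eta> * W \<le> \<epsilon>"
      using \<open>0 < \<epsilon>\<close> \<open>0 \<le> W\<close> by (auto simp: \<eta>_def field_simps)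
    have le: "1 \<le> (1 + \<eta>) * W + (1 + 1 / \<eta>) * (LINT x|lebesgue. (v n x - w x)\<^sup>2)" for n
    proof -
      have "(LINT x|lebesgue. (v n x)\<^sup>2) \<le> (LINT x|lebesgue. (1 + \<eta>) * (w x)\<^sup>2 + (1 + 1 / \<eta>) * (v n x - w x)\<^sup>2)"
      proof (rule integral_mono)
        fix x
        have "(1 + \<eta>) * a\<^sup>2 + (1 + 1 / \<eta>) * b\<^sup>2 - (a + b)\<^sup>2 = (\<eta> * a - b)\<^sup>2 / \<eta>" for a b
          using \<eta>(1) by (simp add: field_simps power2_eq_square)
        then have "0 \<le> (1 + \<eta>) * a\<^sup>2 + (1 + 1 / \<eta>) * b\<^sup>2 - (a + b)\<^sup>2" for a b
          using \<eta>(1) by simp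
        from this[of "w x" "v n x - w x"]
        show "(v n x)\<^sup>2 \<le> (1 + \<eta>) * (w x)\<^sup>2 + (1 + 1 / \<eta>) * (v n x - w x)\<^sup>2"
          by simp
      qed (use X0_D(2)[OF v] X0_D(2)[OF w(1)] X0_D(2)[OF X0_diff[OF v w(1)]] in auto)
      also have "\<dots> = (1 + \<eta>) * W + (1 + 1 / \<eta>) * (LINT x|lebesgue. (v n x - w x)\<^sup>2)"
        using X0_D(2)[OF w(1)] X0_D(2)[OF X0_diff[OF v w(1)]] by (simp add: W)
      finally show ?thesis unfolding v1 .
    qed
    have "(\<lambda>k. (1 + \<eta>) * W + (1 + 1 / \<eta>) * (LINT x|lebesgue. (v (r k) x - w x)\<^sup>2))
        \<longlonglongrightarrow> (1 + \<eta>) * W + (1 + 1 / \<eta>) * 0"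
      by (intro tendsto_intros w(3))
    then have "1 \<le> (1 + \<eta>) * W + (1 + 1 / \<eta>) * 0"
      by (rule LIMSEQ_le_const) (use le in auto)
    then show "1 \<le> W + \<epsilon>" using \<eta>(2) by (simp add: algebra_simps)
  qed
  then have wn: "w \<in> X0_nonzero s \<Omega>"
    using X0_nonzero_integral_pos[OF w(1) \<Omega>'] by (simp add: W_def)
  have "?R w \<le> m"
  proof -
    have "gagliardo_form s w w \<le> m * W"
      using w(2) mult_left_mono[OF \<open>1 \<le> W\<close> m0] by simp
    then show ?thesis using \<open>1 \<le> W\<close> by (simp add: X0_norm_power2 W_def[symmetric] field_simps)
  qed
  with m_le[OF wn] have Rw: "?R w = m" by simp
  have "first_eigenvalue s \<Omega> = m"
    unfolding first_eigenvalue_def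
    by (rule Least_equality) (use wn Rw m_le in auto)
  then show thesis
    using that[OF wn] Rw \<open>1 \<le> W\<close> m0 by (auto simp: X0_norm_power2 W_def[symmetric] field_simps)
qed

section \<open>The nonlinearity\<close>

locale decreasing_quotient =
  fixes f :: "real \<Rightarrow> real" and q :: real
  assumes f_cont: "continuous_on {0..} f"
    and f_nonneg: "0 \<le> t \<Longrightarrow> 0 \<le> f t"
    and q_ge_1: "1 \<le> q"
    and quotient_decreasing: "strict_antimono_on {0<..} (\<lambda>t. f t / t powr (q - 1))"
    and quotient_limit: "((\<lambda>t. f t / t powr (q - 1)) \<longlongrightarrow> 0) at_top"
begin

abbreviation F :: "real \<Rightarrow> real" where "F \<equiv> primitive f"

lemma extend0_nonneg: "0 \<le> extend0 f t"
  using f_nonneg by (auto simp: extend0_def)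

lemma continuous_extend0: "continuous_on UNIV (extend0 f)"
proof -
  have "extend0 f = (\<lambda>t. f (max 0 t))"
    by (auto simp: extend0_def fun_eq_iff max_def)
  moreover have "continuous_on UNIV (\<lambda>t. f (max 0 t))"
    by (rule continuous_on_compose2[OF f_cont]) (auto intro!: continuous_intros)
  ultimately show ?thesis by simp
qed

lemma DERIV_primitive: "(F has_real_derivative extend0 f t) (at t)"
proof -
  let ?b = "\<bar>t\<bar> + 1"
  have "((\<lambda>u. LBINT y=ereal 0..ereal u. extend0 f y) has_vector_derivative extend0 f t) (at t within {- ?b..?b})"
    by (rule interval_integral_FTC2) (use continuous_extend0 continuous_on_subset in auto)
  then have "((\<lambda>u. LBINT y=ereal 0..ereal u. extend0 f y) has_vector_derivative extend0 f t) (at t)"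
    by (subst (asm) at_within_interior) auto
  then show ?thesis
    unfolding has_real_derivative_iff_has_vector_derivative by (simp add: primitive_def[abs_def])
qed

lemma continuous_primitive: "continuous_on A F"
  by (meson DERIV_isCont DERIV_primitive continuous_at_imp_continuous_on)

lemma borel_measurable_primitive [measurable]: "F \<in> borel_measurable borel"
  by (intro borel_measurable_continuous_onI continuous_primitive)

lemma borel_measurable_extend0 [measurable]: "extend0 f \<in> borel_measurable borel"
  by (intro borel_measurable_continuous_onI continuous_extend0)

lemma primitive_0: "F 0 = 0"
  by (simp add: primitive_def)

lemma primitive_mono: "a \<le> b \<Longrightarrow> F a \<le> F b"
  by (rule DERIV_nonneg_imp_nondecreasing) (use DERIV_primitive extend0_nonneg in blast)+

text \<open>The substitution \<open>\<tau> = t powr q\<close> turns the primitive into a concave function, and this is its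
  tangent line at \<open>\<xi> powr q\<close>. Integrated against a weight it does the work of Jensen's inequality.\<close>

lemma primitive_le_tangent:
  assumes "0 < \<xi>" "0 \<le> t"
  shows "F t \<le> F \<xi> + f \<xi> / \<xi> powr (q - 1) / q * (t powr q - \<xi> powr q)"
proof -
  define k where "k = f \<xi> / \<xi> powr (q - 1)"
  define D where "D t = k / q * t powr q - F t" for t
  have D': "(D has_real_derivative k * x powr (q - 1) - f x) (at x)" if "0 < x" for x
  proof -
    have "((\<lambda>t. k / q * t powr q - F t) has_real_derivative k / q * (q * x powr (q - 1)) - extend0 f x) (at x)"
      by (intro DERIV_diff DERIV_cmult DERIV_primitive has_real_derivative_powr that)
    then show ?thesis using q_ge_1 that by (simp add: D_def[abs_def] extend0_def)
  qed
  have contD: "continuous_on {a..b} D" if "0 \<le> a" for a b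
    unfolding D_def using q_ge_1 that
    by (intro continuous_intros continuous_on_powr' continuous_primitive) auto
  have dec: "f y / y powr (q - 1) \<le> f x / x powr (q - 1)" if "0 < x" "x < y" for x y
    using quotient_decreasing that unfolding monotone_on_def by fastforce
  have "D \<xi> \<le> D t"
  proof (cases "\<xi> \<le> t")
    case True
    show ?thesis
    proof (rule DERIV_nonneg_imp_increasing_open[OF True])
      fix x assume "\<xi> < x" "x < t"
      then have "f x \<le> k * x powr (q - 1)"
        using dec[of \<xi> x] \<open>0 < \<xi>\<close> by (simp add: k_def[symmetric] pos_divide_le_eq)
      then show "\<exists>y. (D has_real_derivative y) (at x) \<and> 0 \<le> y"
        using D'[of x] \<open>0 < \<xi>\<close> \<open>\<xi> < x\<close> by (intro exI[of _ "k * x powr (q - 1) - f x"]) auto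
    qed (use contD \<open>0 < \<xi>\<close> in simp)
  next
    case False
    then have "t \<le> \<xi>" by simp
    then show ?thesis
    proof (rule DERIV_nonpos_imp_decreasing_open)
      fix x assume "t < x" "x < \<xi>"
      then have "k * x powr (q - 1) \<le> f x"
        using dec[of x \<xi>] \<open>0 \<le> t\<close> by (simp add: k_def[symmetric] pos_le_divide_eq)
      then show "\<exists>y. (D has_real_derivative y) (at x) \<and> y \<le> 0"
        using D'[of x] \<open>0 \<le> t\<close> \<open>t < x\<close> by (intro exI[of _ "k * x powr (q - 1) - f x"]) auto
    qed (use contD \<open>0 \<le> t\<close> in simp)
  qed
  then show ?thesis
    unfolding D_def k_def[symmetric] right_diff_distrib by linarith
qed

text \<open>The slope of the tangent at infinity is \<open>0\<close>, so the primitive has strictly smaller growth than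
  the power \<open>q\<close>.\<close>

lemma primitive_growth:
  assumes "0 < \<epsilon>"
  obtains C where "0 \<le> C" "\<And>t. F t \<le> \<epsilon> * \<bar>t\<bar> powr q + C"
proof -
  have "\<forall>\<^sub>F t in at_top. f t / t powr (q - 1) < \<epsilon>"
    using quotient_limit assms by (rule order_tendstoD)
  then have "\<forall>\<^sub>F t in at_top. f t / t powr (q - 1) < \<epsilon> \<and> 0 < t"
    using eventually_gt_at_top[of "0::real"] by eventually_elim simp
  then obtain \<xi> where \<xi>: "f \<xi> / \<xi> powr (q - 1) < \<epsilon>" "0 < \<xi>"
    by (metis (mono_tags, lifting) eventually_at_top_linorder order_refl)
  have "f \<xi> / \<xi> powr (q - 1) / q \<le> f \<xi> / \<xi> powr (q - 1) / 1"
    using q_ge_1 \<xi> f_nonneg[of \<xi>] by (intro divide_left_mono) auto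
  then have slope: "f \<xi> / \<xi> powr (q - 1) / q \<le> \<epsilon>" "0 \<le> f \<xi> / \<xi> powr (q - 1) / q"
    using \<xi> q_ge_1 f_nonneg[of \<xi>] by auto
  have "0 \<le> F \<xi>" using primitive_mono[of 0 \<xi>] \<xi> by (simp add: primitive_0)
  moreover have "F t \<le> \<epsilon> * \<bar>t\<bar> powr q + F \<xi>" for t
  proof (cases "0 \<le> t")
    case True
    have "f \<xi> / \<xi> powr (q - 1) / q * (t powr q - \<xi> powr q) \<le> f \<xi> / \<xi> powr (q - 1) / q * t powr q"
      using slope(2) by (intro mult_left_mono) auto
    also have "\<dots> \<le> \<epsilon> * t powr q"
      using slope by (intro mult_right_mono) auto
    finally show ?thesis using primitive_le_tangent[OF \<xi>(2) True] True by simp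
  next
    case False
    then have "F t \<le> 0" using primitive_mono[of t 0] by (simp add: primitive_0)
    moreover have "0 \<le> \<epsilon> * \<bar>t\<bar> powr q" using assms by simp
    ultimately show ?thesis using \<open>0 \<le> F \<xi>\<close> by linarith
  qed
  ultimately show thesis using that by blast
qed

text \<open>Beyond \<open>1\<close> the decreasing quotient is at most its value at \<open>1\<close>; on \<open>[0, 1]\<close> continuity gives a bound.\<close>

lemma extend0_growth:
  obtains C where "0 \<le> C" "\<And>t. extend0 f t \<le> C * (1 + \<bar>t\<bar> powr (q - 1))"
proof -
  have "continuous_on {0..1} f" using f_cont by (rule continuous_on_subset) auto
  then have "bounded (f ` {0..1})"
    by (intro compact_imp_bounded compact_continuous_image) auto
  then obtain B where B: "\<And>t. 0 \<le> t \<Longrightarrow> t \<le> 1 \<Longrightarrow> f t \<le> B"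
    unfolding bounded_iff by (fastforce simp: abs_le_iff)
  have B0: "0 \<le> B" using f_nonneg[of 0] B[of 0] by linarith
  have *: "B \<le> B * (1 + p)" if "0 \<le> p" for p :: real
    using that B0 by (simp add: distrib_left)
  have "extend0 f t \<le> B * (1 + \<bar>t\<bar> powr (q - 1))" for t
  proof -
    consider "t < 0" | "0 \<le> t" "t \<le> 1" | "1 < t" by linarith
    then show ?thesis
    proof cases
      case 1
      then show ?thesis using B[of 0] *[of "\<bar>t\<bar> powr (q - 1)"] by (simp add: extend0_def)
    next
      case 2
      then show ?thesis using B[of t] *[of "\<bar>t\<bar> powr (q - 1)"] by (simp add: extend0_def)
    next
      case 3
      have "f t / t powr (q - 1) < f 1 / 1 powr (q - 1)"
        using quotient_decreasing 3 unfolding monotone_on_def by fastforce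
      then have "f t \<le> f 1 * t powr (q - 1)" using 3 by (simp add: pos_divide_less_eq)
      also have "\<dots> \<le> B * t powr (q - 1)" using B[of 1] by (intro mult_right_mono) auto
      finally show ?thesis using 3 B0 by (simp add: extend0_def distrib_left)
    qed
  qed
  then show thesis using that B0 by blast
qed

text \<open>A majorant for difference quotients of the potential term, uniform in \<open>\<tau>\<close>, which makes
  dominated convergence applicable when the energy is differentiated.\<close>

lemma primitive_difference_bound:
  obtains C where "0 \<le> C"
    "\<And>a b \<tau>. \<bar>\<tau>\<bar> \<le> 1 \<Longrightarrow> \<bar>F (a + \<tau> * b) - F a\<bar> \<le> \<bar>\<tau>\<bar> * (C * (1 + \<bar>a\<bar> powr q + \<bar>b\<bar> powr q))"
proof -
  obtain C where C: "0 \<le> C" "\<And>t. extend0 f t \<le> C * (1 + \<bar>t\<bar> powr (q - 1))"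
    using extend0_growth by blast
  define C' where "C' = 2 * C * 2 powr q"
  have "\<bar>F (a + \<tau> * b) - F a\<bar> \<le> \<bar>\<tau>\<bar> * (C' * (1 + \<bar>a\<bar> powr q + \<bar>b\<bar> powr q))" if \<tau>: "\<bar>\<tau>\<bar> \<le> 1" for a b \<tau>
  proof -
    let ?p = "\<bar>a\<bar> + \<bar>b\<bar>"
    have "\<bar>F (a + \<tau> * b) - F a\<bar> \<le> C * (1 + ?p powr (q - 1)) * \<bar>a + \<tau> * b - a\<bar>"
    proof -
      have "norm (F (a + \<tau> * b) - F a) \<le> C * (1 + ?p powr (q - 1)) * norm (a + \<tau> * b - a)"
      proof (rule field_differentiable_bound)
        show "convex {- ?p..?p}" by simp
        show "(F has_field_derivative extend0 f z) (at z within {- ?p..?p})" for z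
          using DERIV_primitive by (rule DERIV_subset) simp
        show "norm (extend0 f z) \<le> C * (1 + ?p powr (q - 1))" if "z \<in> {- ?p..?p}" for z
        proof -
          have "\<bar>z\<bar> powr (q - 1) \<le> ?p powr (q - 1)"
            using that q_ge_1 by (intro powr_mono2) auto
          then have "C * (1 + \<bar>z\<bar> powr (q - 1)) \<le> C * (1 + ?p powr (q - 1))"
            using C(1) by (intro mult_left_mono) auto
          then show ?thesis using C(2)[of z] extend0_nonneg[of z] by simp
        qed
        have "\<bar>\<tau> * b\<bar> \<le> \<bar>b\<bar>"
          using mult_right_mono[OF \<tau>, of "\<bar>b\<bar>"] by (simp add: abs_mult)
        then show "a + \<tau> * b \<in> {- ?p..?p}" by auto
        show "a \<in> {- ?p..?p}" by auto
      qed
      then show ?thesis by simp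
    qed
    also have "\<dots> = \<bar>\<tau>\<bar> * (C * ((1 + ?p powr (q - 1)) * \<bar>b\<bar>))" by (simp add: abs_mult)
    also have "\<dots> \<le> \<bar>\<tau>\<bar> * (C' * (1 + \<bar>a\<bar> powr q + \<bar>b\<bar> powr q))"
    proof (rule mult_left_mono)
      have "(1 + ?p powr (q - 1)) * \<bar>b\<bar> \<le> (1 + ?p powr (q - 1)) * ?p"
        by (intro mult_left_mono) (auto simp: add_nonneg_nonneg)
      also have "\<dots> = ?p + ?p powr q"
      proof (cases "?p = 0")
        case True
        then have "a = 0" "b = 0" by auto
        then show ?thesis using q_ge_1 by simp
      next
        case False
        then have "0 < ?p" by linarith
        then have "?p powr q = ?p powr (q - 1) * ?p powr 1" by (subst powr_add[symmetric]) simp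
        then show ?thesis using \<open>0 < ?p\<close> by (simp add: algebra_simps)
      qed
      also have "\<dots> \<le> 1 + 2 * ?p powr q"
      proof (cases "?p \<le> 1")
        case False
        then show ?thesis using powr_mono[of 1 q ?p] q_ge_1 by simp
      next
        case True
        have "0 \<le> ?p powr q" by simp
        with True show ?thesis by linarith
      qed
      also have "?p powr q \<le> 2 powr q * (\<bar>a\<bar> powr q + \<bar>b\<bar> powr q)"
      proof -
        have "?p powr q \<le> (2 * max \<bar>a\<bar> \<bar>b\<bar>) powr q" using q_ge_1 by (intro powr_mono2) auto
        also have "\<dots> = 2 powr q * max \<bar>a\<bar> \<bar>b\<bar> powr q" by (simp add: powr_mult)
        also have "\<dots> \<le> 2 powr q * (\<bar>a\<bar> powr q + \<bar>b\<bar> powr q)" by (simp add: max_def)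
        finally show ?thesis .
      qed
      finally have *: "(1 + ?p powr (q - 1)) * \<bar>b\<bar> \<le> 1 + 2 * (2 powr q * (\<bar>a\<bar> powr q + \<bar>b\<bar> powr q))" by simp
      have "(1::real) \<le> 2 powr q" using q_ge_1 by (intro ge_one_powr_ge_zero) auto
      then have "1 + 2 * (2 powr q * (\<bar>a\<bar> powr q + \<bar>b\<bar> powr q)) \<le> 2 * 2 powr q * (1 + \<bar>a\<bar> powr q + \<bar>b\<bar> powr q)"
        by (simp add: distrib_left)
      with * have "(1 + ?p powr (q - 1)) * \<bar>b\<bar> \<le> 2 * 2 powr q * (1 + \<bar>a\<bar> powr q + \<bar>b\<bar> powr q)" by linarith
      then show "C * ((1 + ?p powr (q - 1)) * \<bar>b\<bar>) \<le> C' * (1 + \<bar>a\<bar> powr q + \<bar>b\<bar> powr q)"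
        using mult_left_mono[OF _ C(1)] unfolding C'_def by (simp add: mult.assoc mult.left_commute[of _ C])
    qed simp
    finally show ?thesis .
  qed
  moreover have "0 \<le> C'" using C(1) by (simp add: C'_def)
  ultimately show thesis using that by blast
qed

lemma primitive_bound:
  obtains C where "0 \<le> C" "\<And>t. \<bar>F t\<bar> \<le> C * (1 + \<bar>t\<bar> powr q)"
proof -
  obtain C where C: "0 \<le> C"
    "\<And>a b \<tau>. \<bar>\<tau>\<bar> \<le> 1 \<Longrightarrow> \<bar>F (a + \<tau> * b) - F a\<bar> \<le> \<bar>\<tau>\<bar> * (C * (1 + \<bar>a\<bar> powr q + \<bar>b\<bar> powr q))"
    using primitive_difference_bound by blast
  show thesis
    using that[of C] C(1) C(2)[of 1 0] q_ge_1 by (simp add: primitive_0)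
qed

end

section \<open>The energy functional\<close>

text \<open>The weight \<open>h\<close> enters only through two bounds \<open>a\<close> and \<open>b\<close>, and the Sobolev embedding only through
  one constant \<open>K\<close>. Phrasing \<open>embedding\<close> with a nonnegative integral makes the integrability of
  \<open>\<bar>u\<bar> powr q\<close> a consequence.\<close>

locale energy_functional = decreasing_quotient +
  fixes s :: real and \<Omega> :: "(real^'n) set" and h :: "real^'n \<Rightarrow> real" and a b K :: real
  assumes s_pos: "0 < s"
    and \<Omega>_lmeasurable: "\<Omega> \<in> lmeasurable" and \<Omega>_bounded: "bounded \<Omega>"
    and h_measurable [measurable]: "h \<in> borel_measurable (lebesgue_on \<Omega>)"
    and a_pos: "0 < a"
    and h_ge: "AE x in lebesgue_on \<Omega>. a \<le> h x"
    and h_le: "AE x in lebesgue_on \<Omega>. h x \<le> b"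
    and b_nonneg: "0 \<le> b"
    and K_nonneg: "0 \<le> K"
    and embedding: "u \<in> X0 s \<Omega> \<Longrightarrow>
      (\<integral>\<^sup>+x. ennreal (\<bar>u x\<bar> powr q) \<partial>lebesgue_on \<Omega>) \<le> ennreal (K * X0_norm s u powr q)"
begin

abbreviation "M \<equiv> lebesgue_on \<Omega>"
abbreviation "E u \<equiv> gagliardo_form s u u"
abbreviation "J \<equiv> energy s \<Omega> h f"

sublocale finite_measure "lebesgue_on \<Omega>"
  by (rule finite_measure_lebesgue_on[OF \<Omega>_lmeasurable])

lemma \<Omega>_sets: "\<Omega> \<in> sets lebesgue"
  using \<Omega>_lmeasurable by auto

lemma h_nonneg: "AE x in M. 0 \<le> h x"
  using h_ge by eventually_elim (use a_pos in simp)

lemma integrable_h_mult: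
  assumes "integrable M g"
  shows "integrable M (\<lambda>x. h x * g x)"
proof (rule Bochner_Integration.integrable_bound)
  show "integrable M (\<lambda>x. b * g x)" using assms by simp
  show "AE x in M. norm (h x * g x) \<le> norm (b * g x)"
    using h_nonneg h_le by eventually_elim (simp add: abs_mult mult_right_mono)
qed (use assms in measurable)

lemma integrable_h: "integrable M h"
  using integrable_h_mult[of "\<lambda>_. 1"] by simp

lemma integral_h_mult_le:
  assumes "integrable M g" "\<And>x. 0 \<le> g x"
  shows "(LINT x|M. h x * g x) \<le> b * (LINT x|M. g x)"
proof -
  have "(LINT x|M. h x * g x) \<le> (LINT x|M. b * g x)"
    using h_le by (intro integral_mono_AE integrable_h_mult assms(1))
      (use assms in \<open>auto elim!: eventually_mono intro: mult_right_mono\<close>)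
  then show ?thesis by simp
qed

lemma
  assumes u: "u \<in> X0 s \<Omega>"
  shows integrable_powr: "integrable M (\<lambda>x. \<bar>u x\<bar> powr q)"
    and integral_powr_le: "(LINT x|M. \<bar>u x\<bar> powr q) \<le> K * X0_norm s u powr q"
proof -
  note [measurable] = X0_borel_measurable_on[OF u]
  show int: "integrable M (\<lambda>x. \<bar>u x\<bar> powr q)"
    using embedding[OF u] by (intro integrableI_nonneg) (auto simp: le_less_trans)
  then show "(LINT x|M. \<bar>u x\<bar> powr q) \<le> K * X0_norm s u powr q"
    using embedding[OF u] K_nonneg by (subst (asm) nn_integral_eq_integral) auto
qed

lemma X0_norm_powr_le: "E u \<le> r \<Longrightarrow> X0_norm s u powr q \<le> sqrt r powr q"
  using q_ge_1 by (intro powr_mono2) (auto simp: X0_norm_def gagliardo_form_nonneg)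

lemma integral_powr_ball:
  assumes u: "u \<in> X0 s \<Omega>" and "E u \<le> r"
  shows "(LINT x|M. \<bar>u x\<bar> powr q) \<le> K * sqrt r powr q"
  using integral_powr_le[OF u] mult_left_mono[OF X0_norm_powr_le[OF assms(2)] K_nonneg] by linarith

lemma integrable_primitive:
  assumes u: "u \<in> X0 s \<Omega>"
  shows "integrable M (\<lambda>x. F (u x))"
proof -
  note [measurable] = X0_borel_measurable_on[OF u]
  obtain C where C: "0 \<le> C" "\<And>t. \<bar>F t\<bar> \<le> C * (1 + \<bar>t\<bar> powr q)"
    using primitive_bound by blast
  show ?thesis
  proof (rule Bochner_Integration.integrable_bound)
    show "integrable M (\<lambda>x. C * (1 + \<bar>u x\<bar> powr q))"
      using integrable_powr[OF u] by simp
    show "AE x in M. norm (F (u x)) \<le> norm (C * (1 + \<bar>u x\<bar> powr q))"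
      using C by (intro AE_I2) (auto intro: order_trans)
  qed measurable
qed

lemma integrable_h_primitive: "u \<in> X0 s \<Omega> \<Longrightarrow> integrable M (\<lambda>x. h x * F (u x))"
  by (intro integrable_h_mult integrable_primitive)

lemma energy_eq: "J u = E u / 2 - (LINT x|M. h x * F (u x))"
  by (simp add: energy_def X0_norm_power2)

text \<open>Jensen's inequality for the concave function \<open>\<tau> \<mapsto> F (\<tau> powr (1 / q))\<close> and the weight \<open>h\<close>: integrating
  the tangent line at \<open>\<xi> powr q\<close> leaves a term with the sign of the difference in the last assumption.\<close>

lemma potential_le_Jensen:
  assumes u: "u \<in> X0 s \<Omega>" and \<xi>: "0 < \<xi>"
    and le: "b * (LINT x|M. \<bar>u x\<bar> powr q) \<le> (LINT x|M. h x) * \<xi> powr q"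
  shows "(LINT x|M. h x * F (u x)) \<le> (LINT x|M. h x) * F \<xi>"
proof -
  define k where "k = f \<xi> / \<xi> powr (q - 1) / q"
  have k0: "0 \<le> k" using f_nonneg[of \<xi>] \<xi> q_ge_1 by (simp add: k_def)
  have tangent: "F t \<le> F \<xi> + k * (\<bar>t\<bar> powr q - \<xi> powr q)" for t
    using primitive_mono[OF abs_ge_self[of t]] primitive_le_tangent[OF \<xi> abs_ge_zero[of t]]
    unfolding k_def by linarith
  note int = integrable_powr[OF u] integrable_h_primitive[OF u] integrable_h
  have "(LINT x|M. h x * F (u x)) \<le> (LINT x|M. (F \<xi> - k * \<xi> powr q) * h x + k * (h x * \<bar>u x\<bar> powr q))"
  proof (rule integral_mono_AE)
    show "AE x in M. h x * F (u x) \<le> (F \<xi> - k * \<xi> powr q) * h x + k * (h x * \<bar>u x\<bar> powr q)"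
      using h_nonneg
    proof eventually_elim
      case (elim x)
      then have "h x * F (u x) \<le> h x * (F \<xi> + k * (\<bar>u x\<bar> powr q - \<xi> powr q))"
        by (intro mult_left_mono tangent)
      then show ?case by (simp add: algebra_simps)
    qed
  qed (use int integrable_h_mult[OF int(1)] in auto)
  also have "\<dots> = (F \<xi> - k * \<xi> powr q) * (LINT x|M. h x) + k * (LINT x|M. h x * \<bar>u x\<bar> powr q)"
    using int integrable_h_mult[OF int(1)] by simp
  also have "\<dots> \<le> (F \<xi> - k * \<xi> powr q) * (LINT x|M. h x) + k * ((LINT x|M. h x) * \<xi> powr q)"
    using integral_h_mult_le[OF int(1)] le by (intro add_left_mono mult_left_mono k0) auto
  also have "\<dots> = (LINT x|M. h x) * F \<xi>" by (simp add: algebra_simps)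
  finally show ?thesis .
qed

text \<open>Fatou's lemma applies to \<open>h * (C + \<epsilon> * \<bar>u\<bar> powr q - F u)\<close>, which is non-negative because \<open>F\<close> grows
  more slowly than the power \<open>q\<close>. The auxiliary power term contributes at most \<open>\<epsilon> * b * B\<close>, and \<open>\<epsilon>\<close>
  is arbitrary.\<close>

lemma potential_upper_semicontinuous:
  assumes u: "\<And>n. u n \<in> X0 s \<Omega>" and v: "v \<in> X0 s \<Omega>"
    and AE: "AE x in M. (\<lambda>n. u n x) \<longlonglongrightarrow> v x"
    and B: "\<And>n. (LINT x|M. \<bar>u n x\<bar> powr q) \<le> B"
    and l: "(\<lambda>n. LINT x|M. h x * F (u n x)) \<longlonglongrightarrow> l"
  shows "l \<le> (LINT x|M. h x * F (v x))"
proof -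
  note [measurable] = X0_borel_measurable_on[OF u] X0_borel_measurable_on[OF v]
  have "0 \<le> (LINT x|M. \<bar>u 0 x\<bar> powr q)" by simp
  then have "0 \<le> B" using B[of 0] by linarith
  then have b0: "0 \<le> b * B" using b_nonneg by simp
  have le: "l \<le> (LINT x|M. h x * F (v x)) + \<epsilon> * (b * B)" if \<epsilon>: "0 < \<epsilon>" for \<epsilon>
  proof -
    obtain C where C: "0 \<le> C" "\<And>t. F t \<le> \<epsilon> * \<bar>t\<bar> powr q + C"
      using primitive_growth[OF \<epsilon>] by blast
    let ?g = "\<lambda>w x. C * h x + (\<epsilon> * (h x * \<bar>w x\<bar> powr q) - h x * F (w x))"
    have int: "integrable M (?g w)" if "w \<in> X0 s \<Omega>" for w
      using integrable_h integrable_h_mult[OF integrable_powr[OF that]] integrable_h_primitive[OF that] by simp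
    have integral: "(LINT x|M. ?g w x) = C * (LINT x|M. h x) + (\<epsilon> * (LINT x|M. h x * \<bar>w x\<bar> powr q) - (LINT x|M. h x * F (w x)))"
      if "w \<in> X0 s \<Omega>" for w
      using integrable_h integrable_h_mult[OF integrable_powr[OF that]] integrable_h_primitive[OF that] by simp
    have "(LINT x|M. ?g v x) \<le> C * (LINT x|M. h x) + (\<epsilon> * (b * B) - l)"
    proof (rule integral_Fatou(2))
      show "integrable M (?g (u n))" for n by (rule int[OF u])
      show "AE x in M. 0 \<le> ?g (u n) x" for n
        using h_nonneg
      proof eventually_elim
        case (elim x)
        then have "0 \<le> h x * (C + \<epsilon> * \<bar>u n x\<bar> powr q - F (u n x))"
          using C(2)[of "u n x"] by simp
        then show ?case by (simp add: algebra_simps)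
      qed
      show "?g v \<in> borel_measurable M" by measurable
      show "AE x in M. (\<lambda>n. ?g (u n) x) \<longlonglongrightarrow> ?g v x"
        using AE
      proof eventually_elim
        case (elim x)
        have "(\<lambda>n. F (u n x)) \<longlonglongrightarrow> F (v x)"
          using DERIV_isCont[OF DERIV_primitive] elim by (rule isCont_tendsto_compose)
        moreover have "(\<lambda>n. \<bar>u n x\<bar> powr q) \<longlonglongrightarrow> \<bar>v x\<bar> powr q"
          using elim q_ge_1 by (intro tendsto_powr' tendsto_intros) auto
        ultimately show ?case by (intro tendsto_add tendsto_diff tendsto_mult tendsto_const)
      qed
      have "(LINT x|M. h x * \<bar>u n x\<bar> powr q) \<le> b * B" for n
        using integral_h_mult_le[OF integrable_powr[OF u]] mult_left_mono[OF B b_nonneg]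
        by (rule order_trans) simp
      then show "(LINT x|M. ?g (u n) x) \<le> C * (LINT x|M. h x) + (\<epsilon> * (b * B) - (LINT x|M. h x * F (u n x)))" for n
        unfolding integral[OF u] using \<epsilon> by simp
      show "(\<lambda>n. C * (LINT x|M. h x) + (\<epsilon> * (b * B) - (LINT x|M. h x * F (u n x))))
          \<longlonglongrightarrow> C * (LINT x|M. h x) + (\<epsilon> * (b * B) - l)"
        by (intro tendsto_intros l)
    qed
    moreover have "0 \<le> (LINT x|M. h x * \<bar>v x\<bar> powr q)"
      using h_nonneg by (intro integral_nonneg_AE) (auto elim!: eventually_mono)
    ultimately show ?thesis
      unfolding integral[OF v] using mult_nonneg_nonneg[OF less_imp_le[OF \<epsilon>]] by fastforce
  qed
  show ?thesis
  proof (rule field_le_epsilon)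
    fix e :: real assume "0 < e"
    have "l \<le> (LINT x|M. h x * F (v x)) + e / (b * B + 1) * (b * B)"
      using \<open>0 < e\<close> b0 by (intro le) simp
    also have "e / (b * B + 1) * (b * B) \<le> e"
      using \<open>0 < e\<close> b0 by (simp add: field_simps)
    finally show "l \<le> (LINT x|M. h x * F (v x)) + e" by simp
  qed
qed

text \<open>The direct method. Along a minimizing sequence \<open>J\<close> converges, and so does \<open>E\<close> after thinning out;
  hence the potential term converges too, and its semicontinuity combines with that of \<open>E\<close>.\<close>

lemma minimizer_on_ball:
  assumes r: "0 \<le> r"
  obtains u where "u \<in> X0 s \<Omega>" "E u \<le> r" "\<And>v. v \<in> X0 s \<Omega> \<Longrightarrow> E v \<le> r \<Longrightarrow> J u \<le> J v"
proof -
  let ?A = "{v \<in> X0 s \<Omega>. E v \<le> r}"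
  have zero: "(\<lambda>_. 0) \<in> ?A"
    using r X0_zero gagliardo_form_scale[of s 0 "(\<lambda>_. 0) :: real^'n \<Rightarrow> real"] by simp
  obtain C where C: "0 \<le> C" "\<And>t. F t \<le> 1 * \<bar>t\<bar> powr q + C"
    using primitive_growth[of 1] by auto
  have "bdd_below (J ` ?A)"
  proof (rule bdd_belowI2)
    fix v assume "v \<in> ?A"
    then have v: "v \<in> X0 s \<Omega>" "E v \<le> r" by auto
    let ?g = "\<lambda>x. \<bar>v x\<bar> powr q + C"
    have int: "integrable M ?g" using integrable_powr[OF v(1)] by simp
    have "(LINT x|M. h x * F (v x)) \<le> (LINT x|M. h x * ?g x)"
    proof (rule integral_mono_AE[OF integrable_h_primitive[OF v(1)] integrable_h_mult[OF int]])
      show "AE x in M. h x * F (v x) \<le> h x * ?g x"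
        using h_nonneg by eventually_elim (use C(2) in \<open>auto intro: mult_left_mono\<close>)
    qed
    also have "\<dots> \<le> b * (LINT x|M. ?g x)"
      using C(1) by (intro integral_h_mult_le[OF int]) simp
    also have "\<dots> = b * ((LINT x|M. \<bar>v x\<bar> powr q) + C * measure M (space M))"
      using integrable_powr[OF v(1)] by simp
    also have "\<dots> \<le> b * (K * sqrt r powr q + C * measure M (space M))"
      by (intro mult_left_mono add_right_mono integral_powr_ball v b_nonneg)
    finally show "- (b * (K * sqrt r powr q + C * measure M (space M))) \<le> J v"
      using gagliardo_form_nonneg[of s v] by (simp add: energy_eq)
  qed
  define m where "m = Inf (J ` ?A)"
  have m_le: "m \<le> J v" if "v \<in> X0 s \<Omega>" "E v \<le> r" for v
    unfolding m_def using that \<open>bdd_below (J ` ?A)\<close> by (intro cInf_lower) auto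
  have "\<forall>n. \<exists>v. v \<in> ?A \<and> J v < m + inverse (real (Suc n))"
  proof
    fix n
    show "\<exists>v. v \<in> ?A \<and> J v < m + inverse (real (Suc n))"
      using cInf_lessD[of "J ` ?A" "m + inverse (real (Suc n))"] zero by (auto simp: m_def)
  qed
  then have "\<exists>v. \<forall>n. v n \<in> ?A \<and> J (v n) < m + inverse (real (Suc n))"
    by (rule choice)
  then obtain v0 where v0': "\<forall>n. v0 n \<in> ?A \<and> J (v0 n) < m + inverse (real (Suc n))"
    by (rule exE)
  have v0: "v0 n \<in> X0 s \<Omega>" "E (v0 n) \<le> r" "J (v0 n) < m + inverse (real (Suc n))" for n
    using conjunct1[OF spec[OF v0', of n]] by (simp, simp) (fact conjunct2[OF spec[OF v0']])
  have limJ: "(\<lambda>n. J (v0 n)) \<longlonglongrightarrow> m"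
  proof (rule tendsto_sandwich)
    show "\<forall>\<^sub>F n in sequentially. m \<le> J (v0 n)"
      by (rule always_eventually, rule allI, rule m_le[OF v0(1,2)])
    show "\<forall>\<^sub>F n in sequentially. J (v0 n) \<le> m + inverse (real (Suc n))"
      by (rule always_eventually, rule allI, rule less_imp_le[OF v0(3)])
    show "(\<lambda>n. m + inverse (real (Suc n))) \<longlonglongrightarrow> m"
      using tendsto_add[OF tendsto_const[of m] LIMSEQ_inverse_real_of_nat] by simp
  qed (rule tendsto_const)
  have "bounded (range (\<lambda>n. E (v0 n)))"
    using v0(2) by (intro boundedI[of _ r]) (auto simp: abs_of_nonneg[OF gagliardo_form_nonneg])
  then obtain L r1 where r1: "strict_mono r1" "((\<lambda>n. E (v0 n)) \<circ> r1) \<longlonglongrightarrow> L"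
    using bounded_imp_convergent_subsequence by blast
  define v where "v n = v0 (r1 n)" for n
  have v: "v n \<in> X0 s \<Omega>" "E (v n) \<le> r" for n
    using v0 by (auto simp: v_def)
  have limE: "(\<lambda>n. E (v n)) \<longlonglongrightarrow> L" using r1(2) by (simp add: v_def o_def)
  have limJ': "(\<lambda>n. J (v n)) \<longlonglongrightarrow> m"
    using LIMSEQ_subseq_LIMSEQ[OF limJ r1(1)] by (simp add: v_def o_def)
  have "L \<le> r" by (rule LIMSEQ_le_const2[OF limE]) (use v(2) in auto)
  have L1: "(LINT x|lebesgue. \<bar>v n x\<bar>) \<le> measure lebesgue \<Omega> + K * sqrt r powr q" for n
    using X0_L1_bound[OF v(1) \<Omega>_lmeasurable q_ge_1 integrable_powr[OF v(1)]] integral_powr_ball[OF v(1,2)]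
    by (rule order_trans[OF _ add_left_mono])
  obtain r2 :: "nat \<Rightarrow> nat" and u where u: "strict_mono r2" "u \<in> X0 s \<Omega>" "E u \<le> L"
      "AE x in lebesgue. (\<lambda>k. v (r2 k) x) \<longlonglongrightarrow> u x"
    by (rule X0_compact[OF v(1) s_pos \<Omega>_bounded limE X0_integrable[OF v(1) \<Omega>_lmeasurable] L1])
       (rule that; assumption)
  have AE: "AE x in M. (\<lambda>k. v (r2 k) x) \<longlonglongrightarrow> u x"
    using u(4) \<Omega>_sets by (auto simp: AE_restrict_space_iff elim!: eventually_mono)
  have "(\<lambda>n. E (v n) / 2 - J (v n)) \<longlonglongrightarrow> L / 2 - m"
    by (intro tendsto_intros limE limJ') auto
  then have "(\<lambda>n. LINT x|M. h x * F (v n x)) \<longlonglongrightarrow> L / 2 - m"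
    by (simp add: energy_eq)
  from LIMSEQ_subseq_LIMSEQ[OF this u(1)]
  have "(\<lambda>n. LINT x|M. h x * F (v (r2 n) x)) \<longlonglongrightarrow> L / 2 - m"
    by (simp add: o_def)
  from potential_upper_semicontinuous[OF v(1) u(2) AE integral_powr_ball[OF v] this]
  have "J u \<le> m" using u(3) by (simp add: energy_eq)
  show thesis
    by (rule that[OF u(2)]) (use u(3) \<open>L \<le> r\<close> \<open>J u \<le> m\<close> m_le in \<open>auto intro: order_trans\<close>)
qed

end

section \<open>Critical points of the energy\<close>

context energy_functional
begin

lemma positive_part_contraction: "1-lipschitz_on UNIV (max (0::real))" "max 0 0 = (0::real)"
  by (auto intro!: lipschitz_onI simp: dist_real_def)

lemma
  assumes u: "u \<in> X0 s \<Omega>"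
  shows positive_part_X0: "(\<lambda>x. max 0 (u x)) \<in> X0 s \<Omega>"
    and positive_part_form: "E (\<lambda>x. max 0 (u x)) \<le> E u"
    and positive_part_energy: "J (\<lambda>x. max 0 (u x)) \<le> J u"
proof -
  note contraction = X0_contraction[OF u positive_part_contraction]
    gagliardo_form_contraction[OF u positive_part_contraction]
  show "(\<lambda>x. max 0 (u x)) \<in> X0 s \<Omega>" "E (\<lambda>x. max 0 (u x)) \<le> E u" by (fact contraction)+
  have "(LINT x|M. h x * F (u x)) \<le> (LINT x|M. h x * F (max 0 (u x)))"
  proof (intro integral_mono_AE integrable_h_primitive u contraction(1))
    show "AE x in M. h x * F (u x) \<le> h x * F (max 0 (u x))"
      using h_nonneg by eventually_elim (intro mult_left_mono primitive_mono, auto)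
  qed
  with contraction(2) show "J (\<lambda>x. max 0 (u x)) \<le> J u" by (simp add: energy_eq)
qed

lemma
  assumes u: "u \<in> X0 s \<Omega>" and \<phi>: "\<phi> \<in> X0 s \<Omega>"
  shows integrable_potential_derivative: "integrable M (\<lambda>x. h x * extend0 f (u x) * \<phi> x)"
    and DERIV_potential: "((\<lambda>\<tau>. LINT x|M. h x * F (u x + \<tau> * \<phi> x)) has_real_derivative
      (LINT x|M. h x * extend0 f (u x) * \<phi> x)) (at 0)"
proof -
  note [measurable] = X0_borel_measurable_on[OF u] X0_borel_measurable_on[OF \<phi>]
  obtain C where C: "0 \<le> C"
    "\<And>a b \<tau>. \<bar>\<tau>\<bar> \<le> 1 \<Longrightarrow> \<bar>F (a + \<tau> * b) - F a\<bar> \<le> \<bar>\<tau>\<bar> * (C * (1 + \<bar>a\<bar> powr q + \<bar>b\<bar> powr q))"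
    using primitive_difference_bound by blast
  let ?w = "\<lambda>x. b * (C * (1 + \<bar>u x\<bar> powr q + \<bar>\<phi> x\<bar> powr q))"
  let ?g = "\<lambda>x. h x * extend0 f (u x) * \<phi> x"
  let ?d = "\<lambda>\<tau> x. h x * ((F (u x + \<tau> * \<phi> x) - F (u x)) / \<tau>)"
  have int_w: "integrable M ?w" using integrable_powr[OF u] integrable_powr[OF \<phi>] by simp
  have bound: "AE x in M. norm (?d \<tau> x) \<le> ?w x" if "\<bar>\<tau>\<bar> \<le> 1" for \<tau>
    using h_nonneg h_le
  proof eventually_elim
    case (elim x)
    have W: "0 \<le> C * (1 + \<bar>u x\<bar> powr q + \<bar>\<phi> x\<bar> powr q)"
      using C(1) by (intro mult_nonneg_nonneg add_nonneg_nonneg) auto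
    have "\<bar>(F (u x + \<tau> * \<phi> x) - F (u x)) / \<tau>\<bar> \<le> C * (1 + \<bar>u x\<bar> powr q + \<bar>\<phi> x\<bar> powr q)"
    proof (cases "\<tau> = 0")
      case False
      then show ?thesis
        using C(2)[OF that, of "u x" "\<phi> x"] by (simp add: abs_divide pos_divide_le_eq mult.commute)
    qed (use W in simp)
    then have "\<bar>h x\<bar> * \<bar>(F (u x + \<tau> * \<phi> x) - F (u x)) / \<tau>\<bar> \<le> b * (C * (1 + \<bar>u x\<bar> powr q + \<bar>\<phi> x\<bar> powr q))"
      using elim b_nonneg by (intro mult_mono) auto
    then show ?case by (simp add: abs_mult)
  qed
  have lim: "(\<lambda>i. ?d (X i) x) \<longlonglongrightarrow> ?g x" if X: "X \<longlonglongrightarrow> 0" "\<And>i. X i \<noteq> 0" for X x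
  proof -
    have "((\<lambda>\<tau>. F (u x + \<tau> * \<phi> x)) has_real_derivative extend0 f (u x + 0 * \<phi> x) * \<phi> x) (at 0)"
      by (rule DERIV_chain2[OF DERIV_primitive]) (auto intro!: derivative_eq_intros)
    then have "((\<lambda>\<tau>. (F (u x + \<tau> * \<phi> x) - F (u x)) / \<tau>) \<longlongrightarrow> extend0 f (u x) * \<phi> x) (at 0)"
      by (simp add: has_field_derivative_iff)
    then have "(\<lambda>i. (F (u x + X i * \<phi> x) - F (u x)) / X i) \<longlonglongrightarrow> extend0 f (u x) * \<phi> x"
      using X by (auto simp: tendsto_at_iff_sequentially o_def)
    then show ?thesis unfolding mult.assoc by (intro tendsto_intros)
  qed
  have conv: "integrable M ?g" "(\<lambda>i. LINT x|M. ?d (X i) x) \<longlonglongrightarrow> (LINT x|M. ?g x)"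
    if X: "X \<longlonglongrightarrow> 0" "\<And>i. X i \<noteq> 0" "\<And>i. \<bar>X i\<bar> \<le> 1" for X
  proof -
    note dct = integrable_dominated_convergence[OF _ _ int_w AE_I2[OF lim[OF X(1,2)]] bound[OF X(3)]]
      integral_dominated_convergence[OF _ _ int_w AE_I2[OF lim[OF X(1,2)]] bound[OF X(3)]]
    show "integrable M ?g" by (rule dct) measurable
    show "(\<lambda>i. LINT x|M. ?d (X i) x) \<longlonglongrightarrow> (LINT x|M. ?g x)" by (rule dct) measurable
  qed
  show "integrable M ?g"
    by (rule conv(1)[OF LIMSEQ_inverse_real_of_nat]) (auto simp: field_simps)
  show "((\<lambda>\<tau>. LINT x|M. h x * F (u x + \<tau> * \<phi> x)) has_real_derivative (LINT x|M. ?g x)) (at 0)"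
    unfolding has_field_derivative_iff tendsto_at_iff_sequentially
  proof (intro allI impI)
    \<comment> \<open>The majorant is valid for increments of modulus at most \<open>1\<close>, so an initial segment is dropped.\<close>
    fix X :: "nat \<Rightarrow> real" assume X: "\<forall>i. X i \<in> UNIV - {0}" "X \<longlonglongrightarrow> 0"
    have "\<forall>\<^sub>F i in sequentially. \<bar>X i\<bar> < 1"
      using tendsto_rabs[OF X(2)] by (intro order_tendstoD(2)) auto
    then obtain N where N: "\<And>i. i \<ge> N \<Longrightarrow> \<bar>X i\<bar> < 1" by (auto simp: eventually_sequentially)
    have "(\<lambda>i. LINT x|M. ?d (X (i + N)) x) \<longlonglongrightarrow> (LINT x|M. ?g x)"
      by (rule conv(2)) (use X N in \<open>auto intro: LIMSEQ_ignore_initial_segment less_imp_le\<close>)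
    then have "(\<lambda>i. LINT x|M. ?d (X i) x) \<longlonglongrightarrow> (LINT x|M. ?g x)"
      by (rule LIMSEQ_offset)
    moreover have eq: "(LINT x|M. ?d \<tau> x)
        = ((LINT x|M. h x * F (u x + \<tau> * \<phi> x)) - (LINT x|M. h x * F (u x + 0 * \<phi> x))) / (\<tau> - 0)" for \<tau>
      using integrable_h_primitive[OF X0_add_scale[OF u \<phi>, of \<tau>]] integrable_h_primitive[OF u]
      by (simp add: right_diff_distrib diff_divide_distrib)
    ultimately have "(\<lambda>i. ((LINT x|M. h x * F (u x + X i * \<phi> x)) - (LINT x|M. h x * F (u x + 0 * \<phi> x))) / (X i - 0))
        \<longlonglongrightarrow> (LINT x|M. ?g x)"
      by (simp only: eq)
    then show "((\<lambda>\<tau>. ((LINT x|M. h x * F (u x + \<tau> * \<phi> x)) - (LINT x|M. h x * F (u x + 0 * \<phi> x))) / (\<tau> - 0)) \<circ> X)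
        \<longlonglongrightarrow> (LINT x|M. ?g x)"
      unfolding o_def .
  qed
qed

lemma ball_interior:
  assumes u: "u \<in> X0 s \<Omega>" and "E u < r"
  obtains \<delta> where "0 < \<delta>" "\<And>w. w \<in> X0 s \<Omega> \<Longrightarrow> E w \<le> \<delta> \<Longrightarrow> E (\<lambda>x. u x + w x) \<le> r"
proof -
  define \<eta> where "\<eta> = (r - E u) / (2 * (E u + 1))"
  have Eu: "0 \<le> E u" by (rule gagliardo_form_nonneg)
  then have \<eta>: "0 < \<eta>" "\<eta> * E u \<le> (r - E u) / 2"
    using assms(2) by (auto simp: \<eta>_def field_simps)
  define c where "c = 1 + 1 / \<eta>"
  have pos: "0 < c" using \<eta>(1) by (simp add: c_def add_pos_pos)
  define \<delta> where "\<delta> = (r - E u) / 2 / c"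
  have \<delta>: "c * \<delta> = (r - E u) / 2"
    unfolding \<delta>_def using pos by simp
  show thesis
  proof (rule that)
    show "0 < \<delta>" unfolding \<delta>_def using pos assms(2) by simp
    fix w assume w: "w \<in> X0 s \<Omega>" "E w \<le> \<delta>"
    have "E (\<lambda>x. u x + w x) \<le> (1 + \<eta>) * E u + c * E w"
      unfolding c_def by (rule gagliardo_form_add_le[OF u w(1) \<eta>(1)])
    also have "c * E w \<le> c * \<delta>"
      using w(2) pos by (intro mult_left_mono) auto
    finally have "E (\<lambda>x. u x + w x) \<le> (1 + \<eta>) * E u + c * \<delta>" by simp
    also have "\<dots> = E u + \<eta> * E u + (r - E u) / 2" by (simp add: \<delta> distrib_right)
    also have "\<dots> \<le> E u + (r - E u) / 2 + (r - E u) / 2"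
      by (intro add_right_mono add_left_mono \<eta>(2))
    also have "\<dots> = r" by simp
    finally show "E (\<lambda>x. u x + w x) \<le> r" .
  qed
qed

text \<open>The energy along the line \<open>u + \<tau> * \<phi>\<close> is a quadratic polynomial in \<open>\<tau>\<close> minus a differentiable
  function, with a local minimum at \<open>\<tau> = 0\<close>; its derivative there is the difference of the two sides
  of the weak equation.\<close>

lemma interior_minimizer:
  assumes u: "u \<in> X0 s \<Omega>" "E u < r"
    and min: "\<And>v. v \<in> X0 s \<Omega> \<Longrightarrow> E v \<le> r \<Longrightarrow> J u \<le> J v"
  shows "local_min_on_X0 s \<Omega> J u" and "weak_solution s \<Omega> h f u"
proof -
  obtain \<delta> where \<delta>: "0 < \<delta>" "\<And>w. w \<in> X0 s \<Omega> \<Longrightarrow> E w \<le> \<delta> \<Longrightarrow> E (\<lambda>x. u x + w x) \<le> r"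
    using ball_interior[OF u] by blast
  have near: "J u \<le> J (\<lambda>x. u x + w x)" if "w \<in> X0 s \<Omega>" "E w \<le> \<delta>" for w
    using min[of "\<lambda>x. u x + w x"] \<delta>(2)[OF that] X0_add_scale[OF u(1) that(1), of 1] by simp
  show "local_min_on_X0 s \<Omega> J u"
    unfolding local_min_on_X0_def
  proof (intro conjI u exI[of _ "sqrt \<delta>"] ballI impI)
    show "0 < sqrt \<delta>" using \<delta>(1) by simp
    fix v assume v: "v \<in> X0 s \<Omega>" "X0_norm s (\<lambda>x. v x - u x) < sqrt \<delta>"
    then have "E (\<lambda>x. v x - u x) \<le> \<delta>" by (simp add: X0_norm_def)
    then show "J u \<le> J v" using near[OF X0_diff[OF v(1) u(1)]] by simp
  qed
  show "weak_solution s \<Omega> h f u"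
    unfolding weak_solution_def
  proof (intro conjI u ballI)
    fix \<phi> assume \<phi>: "\<phi> \<in> X0 s \<Omega>"
    show "integrable M (\<lambda>x. h x * extend0 f (u x) * \<phi> x)"
      by (rule integrable_potential_derivative[OF u(1) \<phi>])
    let ?j = "\<lambda>\<tau>. J (\<lambda>x. u x + \<tau> * \<phi> x)"
    have "((\<lambda>\<tau>. (E u + 2 * \<tau> * gagliardo_form s u \<phi> + \<tau>\<^sup>2 * E \<phi>) / 2 - (LINT x|M. h x * F (u x + \<tau> * \<phi> x)))
        has_real_derivative gagliardo_form s u \<phi> - (LINT x|M. h x * extend0 f (u x) * \<phi> x)) (at 0)"
      by (rule DERIV_diff[OF _ DERIV_potential[OF u(1) \<phi>]]) (auto intro!: derivative_eq_intros)
    then have D: "(?j has_real_derivative gagliardo_form s u \<phi> - (LINT x|M. h x * extend0 f (u x) * \<phi> x)) (at 0)"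
      by (simp add: energy_eq gagliardo_form_add_scale[OF u(1) \<phi>])
    define d where "d = sqrt (\<delta> / (E \<phi> + 1))"
    have E\<phi>: "0 < E \<phi> + 1" using gagliardo_form_nonneg[of s \<phi>] by linarith
    have "?j 0 \<le> ?j \<tau>" if "\<bar>0 - \<tau>\<bar> < d" for \<tau>
    proof -
      have "\<bar>\<tau>\<bar> \<le> sqrt (\<delta> / (E \<phi> + 1))" using that by (simp add: d_def)
      then have "\<tau>\<^sup>2 \<le> \<delta> / (E \<phi> + 1)" by (simp add: real_sqrt_ge_abs1 real_le_rsqrt sqrt_ge_absD)
      then have "\<tau>\<^sup>2 * (E \<phi> + 1) \<le> \<delta>" using E\<phi> by (simp add: pos_le_divide_eq)
      then have "\<tau>\<^sup>2 * E \<phi> \<le> \<delta>" by (simp add: distrib_left) (smt (verit) zero_le_power2)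
      then show ?thesis using near[OF X0_scale[OF \<phi>, of \<tau>]] by (simp add: gagliardo_form_scale)
    qed
    moreover have "0 < d" using E\<phi> \<delta>(1) by (simp add: d_def)
    ultimately have "gagliardo_form s u \<phi> - (LINT x|M. h x * extend0 f (u x) * \<phi> x) = 0"
      using DERIV_local_min[OF D] by blast
    then show "gagliardo_form s u \<phi> = (LINT x|M. h x * extend0 f (u x) * \<phi> x)" by simp
  qed
qed

text \<open>Divide the energy of \<open>\<bar>w\<bar> / m\<close> by \<open>1 / m\<^sup>2\<close>. Where \<open>\<bar>w\<bar> / m\<close> is below the threshold \<open>\<delta>\<close> of the quadratic
  lower bound, the potential term is at least \<open>a * c * w\<^sup>2\<close>; elsewhere it is non-negative and may be
  dropped. By dominated convergence the restriction to \<open>\<bar>w\<bar> < m * \<delta>\<close> disappears as \<open>m\<close> grows.\<close>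

lemma negative_energy_near_zero:
  assumes w: "w \<in> X0 s \<Omega>" and c: "0 \<le> c"
    and small: "E w < 2 * (a * c) * (LINT x|M. (w x)\<^sup>2)"
    and F_ge: "\<forall>\<^sub>F \<xi> in at_right 0. c * \<xi>\<^sup>2 \<le> F \<xi>"
    and r: "0 < r"
  obtains v where "v \<in> X0 s \<Omega>" "E v \<le> r" "J v < 0"
proof -
  obtain \<delta> where \<delta>: "0 < \<delta>" "\<And>\<xi>. 0 < \<xi> \<Longrightarrow> \<xi> < \<delta> \<Longrightarrow> c * \<xi>\<^sup>2 \<le> F \<xi>"
    using F_ge unfolding eventually_at_right_field by auto
  have abs_lip: "1-lipschitz_on UNIV (abs :: real \<Rightarrow> real)"
    by (auto intro!: lipschitz_onI simp: dist_real_def)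
  define p where "p = (\<lambda>x. \<bar>w x\<bar>)"
  have p: "p \<in> X0 s \<Omega>" "E p \<le> E w"
    unfolding p_def by (rule X0_contraction[OF w abs_lip], simp) (rule gagliardo_form_contraction[OF w abs_lip], simp)
  note [measurable] = X0_borel_measurable_on[OF p(1)]
  have int_p2: "integrable M (\<lambda>x. (p x)\<^sup>2)"
    using X0_integrable_restrict[OF p(1) \<Omega>_sets, of "\<lambda>t. t\<^sup>2"] X0_D(2)[OF p(1)] by simp
  let ?t = "\<lambda>m::nat. \<lambda>x. inverse (real (Suc m)) * p x"
  let ?k = "\<lambda>m x. indicator {y. inverse (real (Suc m)) * y < \<delta>} (p x) * (p x)\<^sup>2"
  have t: "?t m \<in> X0 s \<Omega>" for m by (rule X0_scale[OF p(1)])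
  have inv_lim: "(\<lambda>m. inverse (real (Suc m)) * y) \<longlonglongrightarrow> 0" for y
    using tendsto_mult[OF LIMSEQ_inverse_real_of_nat tendsto_const[of y]] by simp
  have k_lim: "(\<lambda>m. LINT x|M. ?k m x) \<longlonglongrightarrow> (LINT x|M. (p x)\<^sup>2)"
  proof (rule integral_dominated_convergence[OF _ _ int_p2])
    show "AE x in M. (\<lambda>m. ?k m x) \<longlonglongrightarrow> (p x)\<^sup>2"
    proof (rule AE_I2)
      fix x
      have "\<forall>\<^sub>F m in sequentially. inverse (real (Suc m)) * p x < \<delta>"
        using order_tendstoD(2)[OF inv_lim \<delta>(1)] .
      then have "\<forall>\<^sub>F m in sequentially. ?k m x = (p x)\<^sup>2"
        by eventually_elim simp
      then show "(\<lambda>m. ?k m x) \<longlonglongrightarrow> (p x)\<^sup>2" by (rule tendsto_eventually)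
    qed
  qed (auto intro!: AE_I2 split: split_indicator)
  have J_le: "J (?t m) \<le> (inverse (real (Suc m)))\<^sup>2 * (E w / 2 - a * c * (LINT x|M. ?k m x))" for m
  proof -
    let ?i = "inverse (real (Suc m))"
    have int_k: "integrable M (?k m)"
      by (rule Bochner_Integration.integrable_bound[OF int_p2]) (auto split: split_indicator)
    have "(LINT x|M. ?i\<^sup>2 * (a * c) * ?k m x) \<le> (LINT x|M. h x * F (?t m x))"
    proof (rule integral_mono_AE[OF _ integrable_h_primitive[OF t]])
      show "AE x in M. ?i\<^sup>2 * (a * c) * ?k m x \<le> h x * F (?t m x)"
        using h_ge
      proof eventually_elim
        case (elim x)
        have p0: "0 \<le> p x" by (simp add: p_def)
        have F0: "0 \<le> F (?t m x)"
          using primitive_mono[of 0 "?t m x"] p0 by (simp add: primitive_0)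
        have "c * (indicator {y. ?i * y < \<delta>} (p x) * (?t m x)\<^sup>2) \<le> F (?t m x)"
        proof (cases "?i * p x < \<delta> \<and> 0 < p x")
          case True
          then show ?thesis using \<delta>(2)[of "?t m x"] by simp
        next
          case False
          then show ?thesis using F0 p0 by (auto simp: indicator_def)
        qed
        then have "a * (c * (indicator {y. ?i * y < \<delta>} (p x) * (?t m x)\<^sup>2)) \<le> h x * F (?t m x)"
          using elim a_pos F0 c by (intro mult_mono) auto
        then show ?case by (simp add: power_mult_distrib mult_ac)
      qed
    qed (use int_k in simp)
    then have "?i\<^sup>2 * (a * c) * (LINT x|M. ?k m x) \<le> (LINT x|M. h x * F (?t m x))"
      by simp
    moreover have "E (?t m) \<le> ?i\<^sup>2 * E w"
      unfolding gagliardo_form_scale using p(2) by (intro mult_left_mono) auto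
    ultimately show ?thesis by (simp add: energy_eq algebra_simps)
  qed
  have "(LINT x|M. (p x)\<^sup>2) = (LINT x|M. (w x)\<^sup>2)" by (simp add: p_def)
  with k_lim have "(\<lambda>m. E w / 2 - a * c * (LINT x|M. ?k m x)) \<longlonglongrightarrow> E w / 2 - a * c * (LINT x|M. (w x)\<^sup>2)"
    by (intro tendsto_intros) auto
  then have "\<forall>\<^sub>F m in sequentially. E w / 2 - a * c * (LINT x|M. ?k m x) < 0"
    using small by (intro order_tendstoD(2)) auto
  moreover have "\<forall>\<^sub>F m in sequentially. E (?t m) \<le> r"
  proof -
    have "(\<lambda>m. inverse (real (Suc m)) * (inverse (real (Suc m)) * E p)) \<longlonglongrightarrow> 0 * 0"
      by (intro tendsto_mult LIMSEQ_inverse_real_of_nat inv_lim)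
    then have "(\<lambda>m. E (?t m)) \<longlonglongrightarrow> 0"
      unfolding gagliardo_form_scale by (simp add: power2_eq_square mult.assoc)
    from order_tendstoD(2)[OF this r] show ?thesis by eventually_elim simp
  qed
  ultimately have "\<forall>\<^sub>F m in sequentially. E w / 2 - a * c * (LINT x|M. ?k m x) < 0 \<and> E (?t m) \<le> r"
    by (rule eventually_conj)
  then obtain m where m: "E w / 2 - a * c * (LINT x|M. ?k m x) < 0" "E (?t m) \<le> r"
    by (auto simp: eventually_sequentially)
  have "J (?t m) < 0"
    using J_le[of m] mult_pos_neg[OF _ m(1), of "(inverse (real (Suc m)))\<^sup>2"] by fastforce
  then show thesis by (rule that[OF t m(2)])
qed

end

section \<open>Existence of a non-negative solution\<close>

text \<open>The supremum is approached by a sequence of lower bounds, and countably many null sets can be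
  discarded together.\<close>

lemma essinf_AE: "AE x in M. essinf M f \<le> f x"
proof -
  let ?S = "{z. AE x in M. z \<le> f x}"
  have "?S \<noteq> {}" by (auto intro: exI[of _ "- \<infinity>"])
  then obtain z :: "nat \<Rightarrow> ereal" where z: "range z \<subseteq> ?S" "Sup ?S = (SUP i. z i)"
    using Sup_countable_SUP by metis
  have "AE x in M. \<forall>i. z i \<le> f x"
    unfolding AE_all_countable using z(1) by auto
  then show ?thesis
    by eventually_elim (auto simp: essinf_def z(2) intro: SUP_least)
qed

lemma essential_bounds:
  assumes h: "h \<in> Linfty M" and nonzero: "\<not> (AE x in M. h x = 0)"
    and pos: "0 < essinf M (\<lambda>x. ereal (h x))"
  defines "a \<equiv> real_of_ereal (essinf M (\<lambda>x. ereal (h x)))"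
    and "b \<equiv> real_of_ereal (esssup M (\<lambda>x. ereal (h x)))"
  shows "0 < a" "AE x in M. a \<le> h x" "AE x in M. h x \<le> b" "0 < b"
proof -
  have [measurable]: "h \<in> borel_measurable M" using h by (simp add: Linfty_def)
  have nontrivial: "\<not> (AE x in M. False)"
  proof
    assume "AE x in M. False"
    then have "AE x in M. h x = 0" by eventually_elim simp
    then show False using nonzero by simp
  qed
  have "essinf M (\<lambda>x. ereal (h x)) \<noteq> \<infinity>"
  proof
    assume inf: "essinf M (\<lambda>x. ereal (h x)) = \<infinity>"
    from essinf_AE[of M "\<lambda>x. ereal (h x)"] have "AE x in M. False"
      unfolding inf by eventually_elim simp
    then show False using nontrivial by simp
  qed
  then have a: "ereal a = essinf M (\<lambda>x. ereal (h x))" "0 < a"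
    using pos unfolding a_def by (cases "essinf M (\<lambda>x. ereal (h x))"; simp)+
  show "0 < a" by (fact a)
  show AE_a: "AE x in M. a \<le> h x"
    using essinf_AE[of M "\<lambda>x. ereal (h x)"] unfolding a(1)[symmetric] by simp
  have "esssup M (\<lambda>x. ereal (h x)) \<le> esssup M (\<lambda>x. ereal \<bar>h x\<bar>)"
    by (rule esssup_mono) auto
  also have "\<dots> < \<infinity>" using h by (simp add: Linfty_def)
  finally have fin: "esssup M (\<lambda>x. ereal (h x)) \<noteq> \<infinity>" by simp
  have ge: "ereal a \<le> esssup M (\<lambda>x. ereal (h x))"
  proof (rule ccontr)
    assume less: "\<not> ereal a \<le> esssup M (\<lambda>x. ereal (h x))"
    from AE_a esssup_AE[of "\<lambda>x. ereal (h x)" M] have "AE x in M. False"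
    proof eventually_elim
      case (elim x)
      then have "ereal a \<le> esssup M (\<lambda>x. ereal (h x))"
        by (meson ereal_less_eq(3) order_trans)
      then show ?case using less by simp
    qed
    then show False using nontrivial by simp
  qed
  then have b: "ereal b = esssup M (\<lambda>x. ereal (h x))" "a \<le> b"
    using fin unfolding b_def by (cases "esssup M (\<lambda>x. ereal (h x))"; simp)+
  show "0 < b" using a(2) b(2) by simp
  show "AE x in M. h x \<le> b"
    using esssup_AE[of "\<lambda>x. ereal (h x)" M] unfolding b(1)[symmetric] by simp
qed

text \<open>If the norm vanishes, finiteness of the supremum forces the power integral to vanish as well, by
  the convention that a positive number divided by \<open>0\<close> is infinite in the extended reals.\<close>

lemma embedding_const_bound:
  assumes u: "u \<in> X0 s \<Omega>" and \<Omega>: "\<Omega> \<in> sets lebesgue" and fin: "embedding_const s \<Omega> q \<noteq> \<infinity>"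
  shows "(\<integral>\<^sup>+x. ennreal (\<bar>u x\<bar> powr q) \<partial>lebesgue_on \<Omega>)
    \<le> ennreal (enn2real (embedding_const s \<Omega> q) * X0_norm s u powr q)"
proof (cases "u \<in> X0_nonzero s \<Omega>")
  case True
  let ?I = "\<integral>\<^sup>+x. ennreal (\<bar>u x\<bar> powr q) \<partial>lebesgue_on \<Omega>" and ?x = "ennreal (X0_norm s u powr q)"
  let ?c = "embedding_const s \<Omega> q"
  have le: "?I / ?x \<le> ?c"
    unfolding embedding_const_def using True by (rule SUP_upper)
  have "?I \<le> ?c * ?x"
  proof (cases "?x = 0")
    case zero: True
    have "?I = 0"
    proof (rule ccontr)
      assume "?I \<noteq> 0"
      then have "?I / ?x = \<infinity>" unfolding zero by (simp add: ennreal_divide_zero)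
      then show False using le fin by (simp add: top_unique)
    qed
    then show ?thesis by simp
  next
    case False
    have "?I = ?I / ?x * ?x"
      unfolding ennreal_divide_times by (subst ennreal_divide_self[OF False]) simp_all
    also have "\<dots> \<le> ?c * ?x" using le by (rule mult_right_mono) simp
    finally show ?thesis .
  qed
  also have "?c = ennreal (enn2real ?c)" using fin by (simp add: less_top)
  finally show ?thesis by (simp add: ennreal_mult)
next
  case False
  then have "AE x in lebesgue. u x = 0" using u by (simp add: X0_nonzero_def)
  then have "AE x in lebesgue_on \<Omega>. ennreal (\<bar>u x\<bar> powr q) = 0"
    using \<Omega> by (auto simp: AE_restrict_space_iff elim!: eventually_mono)
  then have "(\<integral>\<^sup>+x. ennreal (\<bar>u x\<bar> powr q) \<partial>lebesgue_on \<Omega>) = (\<integral>\<^sup>+x. 0 \<partial>lebesgue_on \<Omega>)"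
    by (rule nn_integral_cong_AE)
  then show ?thesis by simp
qed

theorem theorem4p2:
  fixes s q \<xi>\<^sub>0 c\<^sub>q :: real
    and \<Omega> :: "(real^'n) set"
    and h :: "real^'n \<Rightarrow> real"
    and f :: "real \<Rightarrow> real"
    and h_inf h_sup h_L1 :: real
  defines "c\<^sub>q \<equiv> enn2real (embedding_const s \<Omega> q)"
    and "h_inf \<equiv> real_of_ereal (essinf (lebesgue_on \<Omega>) (\<lambda>x. ereal (h x)))"
    and "h_sup \<equiv> real_of_ereal (esssup (lebesgue_on \<Omega>) (\<lambda>x. ereal (h x)))"
    and "h_L1 \<equiv> (LINT x|lebesgue_on \<Omega>. \<bar>h x\<bar>)"
  assumes s: "0 < s" "s < 1"
    and dim: "2 * s < real CARD('n)"
    and \<Omega>: "open \<Omega>" "bounded \<Omega>" "lipschitz_boundary \<Omega>"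
    and h: "h \<in> Linfty (lebesgue_on \<Omega>)"
    and h_nonzero: "\<not> (AE x in lebesgue_on \<Omega>. h x = 0)"
    and h_pos: "essinf (lebesgue_on \<Omega>) (\<lambda>x. ereal (h x)) > 0"
    and f: "continuous_on {0..} f" "\<And>t. 0 \<le> t \<Longrightarrow> 0 \<le> f t"
    and q: "1 \<le> q" "q < critical_exponent TYPE('n) s"
    and h1_decreasing: "strict_antimono_on {0<..} (\<lambda>t. f t / t powr (q - 1))"
    and h1_limit: "((\<lambda>t. f t / t powr (q - 1)) \<longlongrightarrow> 0) at_top"
    and h2: "Liminf (at_right 0) (\<lambda>\<xi>. ereal (primitive f \<xi> / \<xi>\<^sup>2))
               > ereal (first_eigenvalue s \<Omega> / (2 * h_inf))"
    and h3: "0 < \<xi>\<^sub>0"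
            "primitive f \<xi>\<^sub>0
               < \<xi>\<^sub>0\<^sup>2 / (2 * (c\<^sub>q * h_sup) powr (2 / q) * h_L1 powr ((q - 2) / q))"
  shows "\<exists>u. weak_solution s \<Omega> h f u
           \<and> (AE x in lebesgue. 0 \<le> u x)
           \<and> \<not> (AE x in lebesgue. u x = 0)
           \<and> local_min_on_X0 s \<Omega> (energy s \<Omega> h f) u
           \<and> gagliardo_form s u u < (h_L1 / (c\<^sub>q * h_sup)) powr (2 / q) * \<xi>\<^sub>0\<^sup>2"
proof -
  have \<Omega>_lm: "\<Omega> \<in> lmeasurable" using \<Omega>(1,2) by (intro bounded_set_imp_lmeasurable) auto
  then have \<Omega>_sets: "\<Omega> \<in> sets lebesgue" by auto
  interpret dq: decreasing_quotient f q
    using f q(1) h1_decreasing h1_limit by unfold_locales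
  note bounds = essential_bounds[OF h h_nonzero h_pos, folded h_inf_def h_sup_def]
  have F0: "0 \<le> primitive f \<xi>\<^sub>0"
    using dq.primitive_mono[of 0 \<xi>\<^sub>0] h3(1) by (simp add: dq.primitive_0)
  \<comment> \<open>A vanishing constant would put \<open>0\<close> on the right-hand side of the second assumption on \<open>\<xi>\<^sub>0\<close>.\<close>
  have "c\<^sub>q \<noteq> 0" using h3(2) F0 q(1) by auto
  then have c_pos: "0 < c\<^sub>q" and c_fin: "embedding_const s \<Omega> q \<noteq> \<infinity>"
    unfolding c\<^sub>q_def by (auto simp: less_le)
  have ne: "X0_nonzero s \<Omega> \<noteq> {}"
  proof
    assume "X0_nonzero s \<Omega> = {}"
    then have "c\<^sub>q = 0" by (simp add: c\<^sub>q_def embedding_const_def bot_ennreal)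
    then show False using c_pos by simp
  qed
  interpret ef: energy_functional f q s \<Omega> h h_inf h_sup c\<^sub>q
    using s(1) \<Omega>_lm \<Omega>(2) h bounds c_pos embedding_const_bound[OF _ \<Omega>_sets c_fin]
    by unfold_locales (auto simp: Linfty_def c\<^sub>q_def)
  have H: "h_L1 = (LINT x|lebesgue_on \<Omega>. h x)"
    unfolding h_L1_def
    by (rule integral_cong_AE) (use ef.h_nonneg in \<open>auto elim!: eventually_mono\<close>)
  have H_pos: "0 < h_L1"
  proof -
    have "0 \<le> h_L1" unfolding h_L1_def by simp
    moreover have "h_L1 \<noteq> 0"
    proof
      assume "h_L1 = 0"
      then have "AE x in lebesgue_on \<Omega>. \<bar>h x\<bar> = 0"
        unfolding h_L1_def using ef.integrable_h
        by (subst (asm) integral_nonneg_eq_0_iff_AE) auto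
      then show False using h_nonzero by simp
    qed
    ultimately show ?thesis by simp
  qed
  define r where "r = (h_L1 / (c\<^sub>q * h_sup)) powr (2 / q) * \<xi>\<^sub>0\<^sup>2"
  have r_pos: "0 < r"
    unfolding r_def using H_pos c_pos bounds(4) h3(1) by simp
  \<comment> \<open>The radius is chosen so that the embedding turns \<open>E \<le> r\<close> into the assumption of the Jensen step at \<open>\<xi>\<^sub>0\<close>.\<close>
  have r_powr: "h_sup * (c\<^sub>q * sqrt r powr q) = h_L1 * \<xi>\<^sub>0 powr q"
  proof -
    have "sqrt r = (h_L1 / (c\<^sub>q * h_sup)) powr (1 / q) * \<xi>\<^sub>0"
      unfolding r_def using h3(1) H_pos c_pos bounds(4)
      by (simp add: real_sqrt_mult powr_half_sqrt[symmetric] powr_powr)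
    then have "sqrt r powr q = h_L1 / (c\<^sub>q * h_sup) * \<xi>\<^sub>0 powr q"
      using h3(1) H_pos c_pos bounds(4) q(1) by (simp add: powr_mult powr_powr)
    then show ?thesis using c_pos bounds(4) by simp
  qed
  have "h_L1 * primitive f \<xi>\<^sub>0 < r / 2"
  proof -
    have "h_L1 = h_L1 powr (2 / q) * h_L1 powr ((q - 2) / q)"
      using H_pos q(1) by (simp add: powr_add[symmetric] add_divide_distrib[symmetric])
    moreover have "h_L1 * primitive f \<xi>\<^sub>0
        < h_L1 * (\<xi>\<^sub>0\<^sup>2 / (2 * (c\<^sub>q * h_sup) powr (2 / q) * h_L1 powr ((q - 2) / q)))"
      using H_pos h3(2) by (intro mult_strict_left_mono)
    ultimately have "h_L1 * primitive f \<xi>\<^sub>0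
        < h_L1 powr (2 / q) * h_L1 powr ((q - 2) / q) * (\<xi>\<^sub>0\<^sup>2 / (2 * (c\<^sub>q * h_sup) powr (2 / q) * h_L1 powr ((q - 2) / q)))"
      by simp
    also have "\<dots> = r / 2"
      unfolding r_def using H_pos c_pos bounds(4) by (simp add: powr_divide)
    finally show ?thesis .
  qed
  then have potential_less: "(LINT x|lebesgue_on \<Omega>. h x * primitive f (v x)) < r / 2"
    if v: "v \<in> X0 s \<Omega>" "gagliardo_form s v v \<le> r" for v
  proof -
    have "h_sup * (LINT x|lebesgue_on \<Omega>. \<bar>v x\<bar> powr q) \<le> h_sup * (c\<^sub>q * sqrt r powr q)"
      using ef.integral_powr_ball[OF v] bounds(4) by (intro mult_left_mono) auto
    then have "h_sup * (LINT x|lebesgue_on \<Omega>. \<bar>v x\<bar> powr q) \<le> (LINT x|lebesgue_on \<Omega>. h x) * \<xi>\<^sub>0 powr q"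
      unfolding r_powr H .
    from ef.potential_le_Jensen[OF v(1) h3(1) this]
    show ?thesis using \<open>h_L1 * primitive f \<xi>\<^sub>0 < r / 2\<close> unfolding H by linarith
  qed
  obtain w where w: "w \<in> X0_nonzero s \<Omega>"
      "gagliardo_form s w w = first_eigenvalue s \<Omega> * (LINT x|lebesgue_on \<Omega>. (w x)\<^sup>2)"
      "0 \<le> first_eigenvalue s \<Omega>"
    by (rule first_eigenvalue_attained[OF s(1) \<Omega>_lm \<Omega>(2) ne]) (rule that; assumption)
  have w_X0: "w \<in> X0 s \<Omega>" using w(1) by (simp add: X0_nonzero_def)
  have w_pos: "0 < (LINT x|lebesgue_on \<Omega>. (w x)\<^sup>2)"
    using w(1) X0_nonzero_integral_pos[OF w_X0 \<Omega>_sets] by simp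
  obtain c where c: "first_eigenvalue s \<Omega> / (2 * h_inf) < c"
      "ereal c < Liminf (at_right 0) (\<lambda>\<xi>. ereal (primitive f \<xi> / \<xi>\<^sup>2))"
    using ereal_dense2[OF h2] by auto
  have "0 \<le> first_eigenvalue s \<Omega> / (2 * h_inf)" using w(3) bounds(1) by simp
  then have "0 \<le> c" using c(1) by linarith
  have ac: "first_eigenvalue s \<Omega> < 2 * (h_inf * c)"
    using c(1) bounds(1) by (simp add: pos_divide_less_eq mult_ac)
  have "gagliardo_form s w w < 2 * (h_inf * c) * (LINT x|lebesgue_on \<Omega>. (w x)\<^sup>2)"
    unfolding w(2) using ac w_pos by (rule mult_strict_right_mono)
  moreover have "\<forall>\<^sub>F \<xi> in at_right 0. c * \<xi>\<^sup>2 \<le> primitive f \<xi>"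
    using less_LiminfD[OF c(2)] eventually_at_right_less[of "0::real"]
    by eventually_elim (simp add: pos_less_divide_eq less_imp_le)
  ultimately obtain v where v: "v \<in> X0 s \<Omega>" "gagliardo_form s v v \<le> r" "energy s \<Omega> h f v < 0"
    using ef.negative_energy_near_zero[OF w_X0 \<open>0 \<le> c\<close> _ _ r_pos] by blast
  obtain u\<^sub>0 where u0: "u\<^sub>0 \<in> X0 s \<Omega>" "gagliardo_form s u\<^sub>0 u\<^sub>0 \<le> r"
      "\<And>v. v \<in> X0 s \<Omega> \<Longrightarrow> gagliardo_form s v v \<le> r \<Longrightarrow> energy s \<Omega> h f u\<^sub>0 \<le> energy s \<Omega> h f v"
    by (rule ef.minimizer_on_ball[OF less_imp_le[OF r_pos]]) (rule that; assumption)
  define u where "u = (\<lambda>x. max 0 (u\<^sub>0 x))"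
  have u: "u \<in> X0 s \<Omega>" "gagliardo_form s u u \<le> r"
    using ef.positive_part_X0[OF u0(1)] ef.positive_part_form[OF u0(1)] u0(2) by (auto simp: u_def)
  have u_min: "energy s \<Omega> h f u \<le> energy s \<Omega> h f v" if "v \<in> X0 s \<Omega>" "gagliardo_form s v v \<le> r" for v
    using ef.positive_part_energy[OF u0(1)] u0(3)[OF that] by (simp add: u_def)
  \<comment> \<open>A negative energy forces the form to be less than twice the potential term, hence less than \<open>r\<close>.\<close>
  have u_neg: "energy s \<Omega> h f u < 0" using u_min[OF v(1,2)] v(3) by simp
  then have u_less: "gagliardo_form s u u < r"
    using potential_less[OF u] by (simp add: ef.energy_eq)
  have "\<not> (AE x in lebesgue. u x = 0)"
  proof
    assume "AE x in lebesgue. u x = 0"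
    then have "AE x in lebesgue_on \<Omega>. h x * primitive f (u x) = 0"
      using \<Omega>_sets by (auto simp: AE_restrict_space_iff dq.primitive_0 elim!: eventually_mono)
    then have "(LINT x|lebesgue_on \<Omega>. h x * primitive f (u x)) = 0"
      by (rule integral_eq_zero_AE)
    then show False using u_neg gagliardo_form_nonneg[of s u] by (simp add: ef.energy_eq)
  qed
  moreover have "AE x in lebesgue. 0 \<le> u x" by (simp add: u_def)
  ultimately show ?thesis
    using ef.interior_minimizer[OF u(1) u_less u_min] u_less unfolding r_def by blast
qed

end
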